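(* Let $G$ be a connected Lie group with Lie algebra $\mathfrak{g}$, let $(\mathrm{g},\sigma)$ be any left-invariant magnetic system on $G$, write $\mathrm{g}=\langle\cdot,\cdot\rangle$, and let $s>0$. Then $$\begin{aligned}{\rm Sec}^{(\mathrm{g},\sigma,s)}(v,w)&=s^2\Big(-\frac34\|[v,w]\|^2-\frac12\langle[[v,w],w],v\rangle-\frac12\langle[v,[v,w]],w\rangle\\&\quad-\langle B(v,v),B(w,w)\rangle+\|B(v,w)\|^2\Big)\\&\quad-s\Big(\langle[w,\mathbf{Y}(v)],w\rangle+\frac12\langle[w,v],\mathbf{Y}(w)\rangle-\frac12\langle[v,\mathbf{Y}(w)],w\rangle-\frac12\langle[w,\mathbf{Y}(w)],v\rangle\Big)\\&\quad+\frac34\langle w,\mathbf{Y}(v)\rangle^2+\frac14\|\mathbf{Y}(w)\|^2\end{aligned}$$ whenever $v,w\in\mathfrak{g}$ are orthonormal, where $B(x,y)=\frac12({\rm ad}_x^\dagger y+{\rm ad}_y^\dagger x)$ for $x,y\in\mathfrak{g}$.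
   Context: A magnetic system on a smooth manifold $M$ is a pair $(\mathrm{g},\sigma)$, where $\mathrm{g}$ is a Riemannian metric on $M$ and $\sigma$ is a closed $2$-form on $M$. Its Lorentz force operator $\mathbf{Y}\colon TM\to TM$ is the skew-adjoint bundle endomorphism characterized by $\sigma_x(v,w)=\mathrm{g}_x(\mathbf{Y}_x(v),w)$ for all $x\in M$, $v,w\in T_xM$. Let $\nabla$ be the Levi-Civita connection of $\mathrm{g}$ and $R^{\mathrm{g}}$ its Riemann curvature tensor, with the sign convention that $\mathrm{g}(R^{\mathrm{g}}(w,v)v,w)$ is the Riemannian sectional curvature of the plane spanned by orthonormal $v,w$. For $x\in M$ and a unit vector $v\in T_xM$, split $T_xM=\mathbb{R}v\oplus v^\perp$ orthogonally and let $(\cdot)^\top$, $(\cdot)^\perp$ denote the orthogonal projections onto $\mathbb{R}v$ and $v^\perp$. For $s>0$ and $w\in v^\perp$ set $$R^{(\mathrm{g},\sigma,s)}_{(x,v)}(w)=s^2R^{\mathrm{g}}_x(w,v)v-s(\nabla_w\mathbf{Y})(v)+\tfrac{s}{2}\big((\nabla_v\mathbf{Y})(w)\big)^\perp,$$ $$A^{(\mathrm{g},\sigma)}_{(x,v)}(w)=-\tfrac34\mathbf{Y}_x\big(\mathbf{Y}_x(w)^\top\big)-\tfrac14\big(\mathbf{Y}_x^2(w)\big)^\perp.$$ The $s$-magnetic sectional curvature of $(\mathrm{g},\sigma)$ is the function on ordered orthonormal pairs $(v,w)$ of vectors in $T_xM$, $x\in M$, given by $${\rm Sec}^{(\mathrm{g},\sigma,s)}_x(v,w)=\mathrm{g}_x\big(R^{(\mathrm{g},\sigma,s)}_{(x,v)}(w)+A^{(\mathrm{g},\sigma)}_{(x,v)}(w),w\big).$$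 A magnetic system $(\mathrm{g},\sigma)$ on a Lie group $G$ is left-invariant if all left translations preserve both $\mathrm{g}$ and $\sigma$. Curvatures are evaluated at the identity $e\in G$, with $\mathfrak{g}=T_eG$ identified with left-invariant vector fields; ${\rm Sec}^{(\mathrm{g},\sigma,s)}(v,w)$ and $\mathbf{Y}$ stand for ${\rm Sec}^{(\mathrm{g},\sigma,s)}_e(v,w)$ and $\mathbf{Y}_e$. For $x\in\mathfrak{g}$, ${\rm ad}_xy=[x,y]$, and ${\rm ad}_x^\dagger$ is the adjoint of ${\rm ad}_x$ with respect to $\langle\cdot,\cdot\rangle$, i.e. $\langle{\rm ad}_xy,z\rangle=\langle y,{\rm ad}_x^\dagger z\rangle$ for all $y,z\in\mathfrak{g}$. *)

theory Defs
  imports "HOL-Analysis.Analysis" "HOL-Library.Function_Algebras"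
begin

section \<open>Smooth manifolds\<close>

fun Ck_on :: "nat \<Rightarrow> 'a::euclidean_space set \<Rightarrow> ('a \<Rightarrow> 'b::real_normed_vector) \<Rightarrow> bool" where
  "Ck_on 0 S f \<longleftrightarrow> continuous_on S f"
| "Ck_on (Suc k) S f \<longleftrightarrow>
     (\<forall>x\<in>S. f differentiable (at x)) \<and> (\<forall>v. Ck_on k S (\<lambda>x. frechet_derivative f (at x) v))"

text \<open>Used for open sets \<open>S\<close> only.\<close>

definition smooth_on :: "'a::euclidean_space set \<Rightarrow> ('a \<Rightarrow> 'b::real_normed_vector) \<Rightarrow> bool" where
  "smooth_on S f \<longleftrightarrow> (\<forall>k. Ck_on k S f)"

text \<open>A chart is a pair of a coordinate domain and a coordinate map; the values of the coordinate
  map outside of its domain are irrelevant. The underlying point set of a manifold is a whole type,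
  and its dimension is \<open>DIM('e)\<close>.\<close>

type_synonym ('m, 'e) chart = "'m set \<times> ('m \<Rightarrow> 'e)"

definition is_chart :: "('m::topological_space, 'e::euclidean_space) chart \<Rightarrow> bool" where
  "is_chart = (\<lambda>(U, \<phi>). open U \<and> open (\<phi> ` U) \<and> homeomorphism U (\<phi> ` U) \<phi> (inv_into U \<phi>))"

text \<open>The atlas is not required to be maximal.\<close>

definition smooth_manifold ::
    "('m::{t2_space, second_countable_topology}, 'e::euclidean_space) chart set \<Rightarrow> bool" where
  "smooth_manifold A \<longleftrightarrow>
     (\<forall>c\<in>A. is_chart c) \<and> (\<Union>(U, \<phi>)\<in>A. U) = UNIV \<and>
     (\<forall>(U, \<phi>)\<in>A. \<forall>(V, \<psi>)\<in>A. smooth_on (\<phi> ` (U \<inter> V)) (\<psi> \<circ> inv_into U \<phi>))"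

definition prod_atlas ::
    "('m, 'd) chart set \<Rightarrow> ('n, 'e) chart set \<Rightarrow> ('m \<times> 'n, 'd \<times> 'e) chart set" where
  "prod_atlas A B = {(U \<times> V, map_prod \<phi> \<psi>) |U \<phi> V \<psi>. (U, \<phi>) \<in> A \<and> (V, \<psi>) \<in> B}"

definition smooth_map ::
    "('m::topological_space, 'd::euclidean_space) chart set \<Rightarrow>
     ('n::topological_space, 'e::euclidean_space) chart set \<Rightarrow> ('m \<Rightarrow> 'n) \<Rightarrow> bool" where
  "smooth_map A B F \<longleftrightarrow> continuous_on UNIV F \<and>
     (\<forall>(U, \<phi>)\<in>A. \<forall>(V, \<psi>)\<in>B. smooth_on (\<phi> ` (U \<inter> F -` V)) (\<psi> \<circ> F \<circ> inv_into U \<phi>))"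

text \<open>\<open>smooth_fun A W f\<close>: the restriction of \<open>f\<close> to the open set \<open>W\<close> is smooth.
  \<open>smooth_at A p f\<close>: \<open>f\<close> is smooth on some neighbourhood of \<open>p\<close>.\<close>

definition smooth_fun ::
    "('m::topological_space, 'e::euclidean_space) chart set \<Rightarrow> 'm set \<Rightarrow> ('m \<Rightarrow> real) \<Rightarrow> bool" where
  "smooth_fun A W f \<longleftrightarrow> (\<forall>(U, \<phi>)\<in>A. smooth_on (\<phi> ` (U \<inter> W)) (f \<circ> inv_into U \<phi>))"

definition smooth_at ::
    "('m::topological_space, 'e::euclidean_space) chart set \<Rightarrow> 'm \<Rightarrow> ('m \<Rightarrow> real) \<Rightarrow> bool" where
  "smooth_at A p f \<longleftrightarrow> (\<exists>W. open W \<and> p \<in> W \<and> smooth_fun A W f)"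


section \<open>Tangent vectors and vector fields\<close>

text \<open>A tangent vector at \<open>p\<close> is an operator on the functions that are smooth near \<open>p\<close>, namely a
  directional derivative (a combination of the coordinate derivations) in a chart around \<open>p\<close>. To
  have a total function it is given the value 0 on all other functions, so that by the chain rule
  the space of these operators does not depend on the chart. Sums of tangent vectors and of vector
  fields are pointwise sums of functions.\<close>

type_synonym 'm tvec = "('m \<Rightarrow> real) \<Rightarrow> real"
type_synonym 'm vfield = "'m \<Rightarrow> 'm tvec"

definition tangent_space ::
    "('m::topological_space, 'e::euclidean_space) chart set \<Rightarrow> 'm \<Rightarrow> 'm tvec set" where
  "tangent_space A p =
     {(\<lambda>f. if smooth_at A p f then frechet_derivative (f \<circ> inv_into U \<phi>) (at (\<phi> p)) u else 0)
       |U \<phi> u. (U, \<phi>) \<in> A \<and> p \<in> U}"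

definition tscale :: "real \<Rightarrow> 'm tvec \<Rightarrow> 'm tvec"  (infixr \<open>\<star>\<close> 75) where
  "c \<star> v = (\<lambda>f. c * v f)"

definition fscale :: "('m \<Rightarrow> real) \<Rightarrow> 'm vfield \<Rightarrow> 'm vfield" where
  "fscale h X = (\<lambda>p. h p \<star> X p)"

definition push_forward ::
    "('m::topological_space, 'd::euclidean_space) chart set \<Rightarrow>
     ('n::topological_space, 'e::euclidean_space) chart set \<Rightarrow>
     ('m \<Rightarrow> 'n) \<Rightarrow> 'm \<Rightarrow> 'm tvec \<Rightarrow> 'n tvec" where
  "push_forward A B F p v = (\<lambda>f. if smooth_at B (F p) f then v (f \<circ> F) else 0)"

definition vector_fields ::
    "('m::topological_space, 'e::euclidean_space) chart set \<Rightarrow> 'm vfield set" where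
  "vector_fields A =
     {X. (\<forall>p. X p \<in> tangent_space A p) \<and>
         (\<forall>W f. open W \<and> smooth_fun A W f \<longrightarrow> smooth_fun A W (\<lambda>p. X p f))}"

definition bracket ::
    "('m::topological_space, 'e::euclidean_space) chart set \<Rightarrow> 'm vfield \<Rightarrow> 'm vfield \<Rightarrow> 'm vfield" where
  "bracket A X Y =
     (\<lambda>p f. if smooth_at A p f then X p (\<lambda>q. Y q f) - Y p (\<lambda>q. X q f) else 0)"


section \<open>Magnetic systems\<close>

text \<open>A covariant 2-tensor field; smoothness is tested on smooth vector fields.\<close>

type_synonym 'm tensor2 = "'m \<Rightarrow> 'm tvec \<Rightarrow> 'm tvec \<Rightarrow> real"

definition smooth_tensor2 ::
    "('m::topological_space, 'e::euclidean_space) chart set \<Rightarrow> 'm tensor2 \<Rightarrow> bool" where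
  "smooth_tensor2 A b \<longleftrightarrow>
     (\<forall>p. \<forall>u\<in>tangent_space A p. \<forall>v\<in>tangent_space A p. \<forall>w\<in>tangent_space A p. \<forall>c.
        b p (u + v) w = b p u w + b p v w \<and> b p u (v + w) = b p u v + b p u w \<and>
        b p (c \<star> u) v = c * b p u v \<and> b p u (c \<star> v) = c * b p u v) \<and>
     (\<forall>X\<in>vector_fields A. \<forall>Y\<in>vector_fields A. smooth_fun A UNIV (\<lambda>p. b p (X p) (Y p)))"

definition riemannian_metric ::
    "('m::topological_space, 'e::euclidean_space) chart set \<Rightarrow> 'm tensor2 \<Rightarrow> bool" where
  "riemannian_metric A g \<longleftrightarrow> smooth_tensor2 A g \<and>
     (\<forall>p. \<forall>u\<in>tangent_space A p. \<forall>v\<in>tangent_space A p. g p u v = g p v u) \<and>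
     (\<forall>p. \<forall>u\<in>tangent_space A p. u \<noteq> 0 \<longrightarrow> g p u u > 0)"

definition two_form ::
    "('m::topological_space, 'e::euclidean_space) chart set \<Rightarrow> 'm tensor2 \<Rightarrow> bool" where
  "two_form A \<sigma> \<longleftrightarrow> smooth_tensor2 A \<sigma> \<and> (\<forall>p. \<forall>u\<in>tangent_space A p. \<sigma> p u u = 0)"

text \<open>The invariant (coordinate-free) formula for the exterior derivative.\<close>

definition exterior_deriv2 ::
    "('m::topological_space, 'e::euclidean_space) chart set \<Rightarrow> 'm tensor2 \<Rightarrow>
     'm vfield \<Rightarrow> 'm vfield \<Rightarrow> 'm vfield \<Rightarrow> 'm \<Rightarrow> real" where
  "exterior_deriv2 A \<sigma> X Y Z p =
     X p (\<lambda>q. \<sigma> q (Y q) (Z q)) - Y p (\<lambda>q. \<sigma> q (X q) (Z q)) + Z p (\<lambda>q. \<sigma> q (X q) (Y q))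
     - \<sigma> p (bracket A X Y p) (Z p) + \<sigma> p (bracket A X Z p) (Y p) - \<sigma> p (bracket A Y Z p) (X p)"

definition closed_two_form ::
    "('m::topological_space, 'e::euclidean_space) chart set \<Rightarrow> 'm tensor2 \<Rightarrow> bool" where
  "closed_two_form A \<sigma> \<longleftrightarrow> two_form A \<sigma> \<and>
     (\<forall>X\<in>vector_fields A. \<forall>Y\<in>vector_fields A. \<forall>Z\<in>vector_fields A. \<forall>p.
        exterior_deriv2 A \<sigma> X Y Z p = 0)"

definition magnetic_system ::
    "('m::topological_space, 'e::euclidean_space) chart set \<Rightarrow> 'm tensor2 \<Rightarrow> 'm tensor2 \<Rightarrow> bool" where
  "magnetic_system A g \<sigma> \<longleftrightarrow> riemannian_metric A g \<and> closed_two_form A \<sigma>"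

definition lorentz_force ::
    "('m::topological_space, 'e::euclidean_space) chart set \<Rightarrow> 'm tensor2 \<Rightarrow> 'm tensor2 \<Rightarrow>
     'm \<Rightarrow> 'm tvec \<Rightarrow> 'm tvec" where
  "lorentz_force A g \<sigma> p v =
     (THE u. u \<in> tangent_space A p \<and> (\<forall>w\<in>tangent_space A p. \<sigma> p v w = g p u w))"


section \<open>Levi-Civita connection and magnetic sectional curvature\<close>

definition affine_connection ::
    "('m::topological_space, 'e::euclidean_space) chart set \<Rightarrow>
     ('m vfield \<Rightarrow> 'm vfield \<Rightarrow> 'm vfield) \<Rightarrow> bool" where
  "affine_connection A nabla \<longleftrightarrow>
     (\<forall>X\<in>vector_fields A. \<forall>Y\<in>vector_fields A. nabla X Y \<in> vector_fields A) \<and>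
     (\<forall>X\<in>vector_fields A. \<forall>Y\<in>vector_fields A. \<forall>Z\<in>vector_fields A.
        nabla (X + Y) Z = nabla X Z + nabla Y Z \<and> nabla X (Y + Z) = nabla X Y + nabla X Z) \<and>
     (\<forall>X\<in>vector_fields A. \<forall>Y\<in>vector_fields A. \<forall>h. smooth_fun A UNIV h \<longrightarrow>
        nabla (fscale h X) Y = fscale h (nabla X Y) \<and>
        nabla X (fscale h Y) = fscale (\<lambda>p. X p h) Y + fscale h (nabla X Y))"

text \<open>\<open>nabla\<close> is the (unique) torsion-free metric connection of \<open>g\<close>. Only its values on smooth vector
  fields are determined, and only these enter the curvature below.\<close>

definition levi_civita ::
    "('m::topological_space, 'e::euclidean_space) chart set \<Rightarrow> 'm tensor2 \<Rightarrow>
     ('m vfield \<Rightarrow> 'm vfield \<Rightarrow> 'm vfield) \<Rightarrow> bool" where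
  "levi_civita A g nabla \<longleftrightarrow> affine_connection A nabla \<and>
     (\<forall>X\<in>vector_fields A. \<forall>Y\<in>vector_fields A. nabla X Y - nabla Y X = bracket A X Y) \<and>
     (\<forall>X\<in>vector_fields A. \<forall>Y\<in>vector_fields A. \<forall>Z\<in>vector_fields A. \<forall>p.
        X p (\<lambda>q. g q (Y q) (Z q)) = g p (nabla X Y p) (Z p) + g p (Y p) (nabla X Z p))"

text \<open>Tensor fields built from a connection are evaluated on tangent vectors by extending these to
  global smooth vector fields; by tensoriality the choice of the extension is irrelevant.\<close>

definition extend ::
    "('m::topological_space, 'e::euclidean_space) chart set \<Rightarrow> 'm \<Rightarrow> 'm tvec \<Rightarrow> 'm vfield" where
  "extend A p v = (SOME X. X \<in> vector_fields A \<and> X p = v)"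

definition curvature_at ::
    "('m::topological_space, 'e::euclidean_space) chart set \<Rightarrow>
     ('m vfield \<Rightarrow> 'm vfield \<Rightarrow> 'm vfield) \<Rightarrow> 'm \<Rightarrow> 'm tvec \<Rightarrow> 'm tvec \<Rightarrow> 'm tvec \<Rightarrow> 'm tvec" where
  "curvature_at A nabla p u v w =
     (let X = extend A p u; Y = extend A p v; Z = extend A p w
      in (nabla X (nabla Y Z) - nabla Y (nabla X Z) - nabla (bracket A X Y) Z) p)"

text \<open>\<open>cov_deriv_at A nabla L p u v\<close> is \<open>(\<nabla>\<^sub>u L)(v)\<close> for a bundle endomorphism \<open>L\<close>.\<close>

definition cov_deriv_at ::
    "('m::topological_space, 'e::euclidean_space) chart set \<Rightarrow>
     ('m vfield \<Rightarrow> 'm vfield \<Rightarrow> 'm vfield) \<Rightarrow> ('m \<Rightarrow> 'm tvec \<Rightarrow> 'm tvec) \<Rightarrow>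
     'm \<Rightarrow> 'm tvec \<Rightarrow> 'm tvec \<Rightarrow> 'm tvec" where
  "cov_deriv_at A nabla L p u v =
     (let X = extend A p u; Y = extend A p v
      in nabla X (\<lambda>q. L q (Y q)) p - L p (nabla X Y p))"

text \<open>Orthogonal projections onto the line spanned by a unit vector \<open>v\<close> and onto its complement.\<close>

definition proj_top :: "'m tensor2 \<Rightarrow> 'm \<Rightarrow> 'm tvec \<Rightarrow> 'm tvec \<Rightarrow> 'm tvec" where
  "proj_top g p v u = g p u v \<star> v"

definition proj_perp :: "'m tensor2 \<Rightarrow> 'm \<Rightarrow> 'm tvec \<Rightarrow> 'm tvec \<Rightarrow> 'm tvec" where
  "proj_perp g p v u = u - proj_top g p v u"

definition magnetic_R ::
    "('m::topological_space, 'e::euclidean_space) chart set \<Rightarrow> 'm tensor2 \<Rightarrow> 'm tensor2 \<Rightarrow>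
     ('m vfield \<Rightarrow> 'm vfield \<Rightarrow> 'm vfield) \<Rightarrow> real \<Rightarrow> 'm \<Rightarrow> 'm tvec \<Rightarrow> 'm tvec \<Rightarrow> 'm tvec" where
  "magnetic_R A g \<sigma> nabla s p v w =
     (let Y = lorentz_force A g \<sigma>
      in s\<^sup>2 \<star> curvature_at A nabla p w v v - s \<star> cov_deriv_at A nabla Y p w v
         + (s / 2) \<star> proj_perp g p v (cov_deriv_at A nabla Y p v w))"

definition magnetic_A ::
    "('m::topological_space, 'e::euclidean_space) chart set \<Rightarrow> 'm tensor2 \<Rightarrow> 'm tensor2 \<Rightarrow>
     'm \<Rightarrow> 'm tvec \<Rightarrow> 'm tvec \<Rightarrow> 'm tvec" where
  "magnetic_A A g \<sigma> p v w =
     (let Y = lorentz_force A g \<sigma> p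
      in (- 3 / 4) \<star> Y (proj_top g p v (Y w)) - (1 / 4) \<star> proj_perp g p v (Y (Y w)))"

text \<open>Here \<open>nabla\<close> is meant to be the Levi-Civita connection of \<open>g\<close>, and \<open>v\<close>, \<open>w\<close> orthonormal.\<close>

definition magnetic_sec ::
    "('m::topological_space, 'e::euclidean_space) chart set \<Rightarrow> 'm tensor2 \<Rightarrow> 'm tensor2 \<Rightarrow>
     ('m vfield \<Rightarrow> 'm vfield \<Rightarrow> 'm vfield) \<Rightarrow> real \<Rightarrow> 'm \<Rightarrow> 'm tvec \<Rightarrow> 'm tvec \<Rightarrow> real" where
  "magnetic_sec A g \<sigma> nabla s p v w =
     g p (magnetic_R A g \<sigma> nabla s p v w + magnetic_A A g \<sigma> p v w) w"


section \<open>Lie groups\<close>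

text \<open>The class \<open>group_add\<close> does not assume commutativity: the group operation is written \<open>+\<close>, the
  inverse is unary minus and the identity element is \<open>0\<close>.\<close>

definition lie_group ::
    "('g::{t2_space, second_countable_topology, group_add}, 'e::euclidean_space) chart set \<Rightarrow> bool" where
  "lie_group A \<longleftrightarrow> smooth_manifold A \<and>
     smooth_map (prod_atlas A A) A (\<lambda>(x, y). x + y) \<and> smooth_map A A uminus"

definition left_invariant ::
    "('g::{topological_space, group_add}, 'e::euclidean_space) chart set \<Rightarrow> 'g tensor2 \<Rightarrow> bool" where
  "left_invariant A b \<longleftrightarrow>
     (\<forall>a p. \<forall>u\<in>tangent_space A p. \<forall>v\<in>tangent_space A p.
        b (a + p) (push_forward A A ((+) a) p u) (push_forward A A ((+) a) p v) = b p u v)"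

definition left_inv_field ::
    "('g::{topological_space, group_add}, 'e::euclidean_space) chart set \<Rightarrow> 'g tvec \<Rightarrow> 'g vfield" where
  "left_inv_field A v = (\<lambda>x. push_forward A A ((+) x) 0 v)"

text \<open>The Lie algebra is \<open>tangent_space A 0\<close>.\<close>

definition lie_bracket ::
    "('g::{topological_space, group_add}, 'e::euclidean_space) chart set \<Rightarrow>
     'g tvec \<Rightarrow> 'g tvec \<Rightarrow> 'g tvec" where
  "lie_bracket A v w = bracket A (left_inv_field A v) (left_inv_field A w) 0"

definition ad_adjoint ::
    "('g::{topological_space, group_add}, 'e::euclidean_space) chart set \<Rightarrow> 'g tensor2 \<Rightarrow>
     'g tvec \<Rightarrow> 'g tvec \<Rightarrow> 'g tvec" where
  "ad_adjoint A g x z =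
     (THE u. u \<in> tangent_space A 0 \<and>
        (\<forall>y\<in>tangent_space A 0. g 0 (lie_bracket A x y) z = g 0 y u))"

end

theory Submission
  imports Defs
begin

text \<open>Left-invariant fields have constant mutual inner products, so for them the Koszul formula
  loses its derivative terms: the Levi-Civita connection on \<open>\<gg>\<close> is the algebraic operation
  \<open>\<nabla>\<^sub>x y = [x, y] / 2 - B(x, y)\<close> (\<open>koszul\<close>, \<open>conn_eq\<close>), skew in its second argument. When a
  curvature component \<open>\<langle>R(w, v) v, w\<rangle>\<close> is computed with left-invariant fields, the scalar
  \<open>\<langle>\<nabla>\<^sub>y z, u\<rangle>\<close> is constant too, so second covariant derivatives become products of first ones
  (\<open>ip_second_derivative\<close>):
  \<open>\<langle>R(w, v) v, w\<rangle> = - \<langle>\<nabla>\<^sub>v v, \<nabla>\<^sub>w w\<rangle> + \<langle>\<nabla>\<^sub>w v, \<nabla>\<^sub>v w\<rangle> - \<langle>\<nabla>\<^bsub>[w, v]\<^esub> v, w\<rangle>\<close>.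
  Substituting the formula for \<open>\<nabla>\<close> gives the terms with \<open>s\<^sup>2\<close> (\<open>ip_sectional_curvature\<close>).

  The Lorentz force \<open>Y\<close> maps left-invariant fields to left-invariant fields and is skew. Hence
  \<open>\<langle>(\<nabla>\<^sub>u Y) v, w\<rangle> = \<langle>\<nabla>\<^sub>u (Y v), w\<rangle> + \<langle>\<nabla>\<^sub>u v, Y w\<rangle>\<close> (\<open>ip_cov_deriv\<close>). This is skew in \<open>v, w\<close>, so the
  term with \<open>\<nabla>\<^sub>v Y\<close> does not contribute to the magnetic sectional curvature, and the term with
  \<open>\<nabla>\<^sub>w Y\<close> is evaluated by the Koszul formula. The last two terms use only the skewness of \<open>Y\<close>.

  It remains to justify the computation with left-invariant fields. These are smooth because
  multiplication is (\<open>left_inv_smooth\<close>), and an orthonormal basis of \<open>\<gg>\<close>, obtained by the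
  Gram--Schmidt process, extends to a global left-invariant orthonormal frame (\<open>frame_exists\<close>).
  Every vector field is a combination of the frame with smooth coefficients, so an expression that
  is linear over the smooth functions depends only on the value of the field at the point
  (\<open>tensorial_pointwise\<close>). The curvature and \<open>\<nabla>Y\<close>, defined through arbitrary extensions of
  tangent vectors, may therefore be computed with left-invariant extensions.\<close>


section \<open>Calculus of smooth maps between Euclidean spaces\<close>

lemma frechet_derivative_eqI: "(f has_derivative f') (at x) \<Longrightarrow> frechet_derivative f (at x) = f'"
  using frechet_derivative_at by metis

lemma frechet_derivative_cong_open:
  assumes "open S" "x \<in> S" "\<And>y. y \<in> S \<Longrightarrow> f y = g y" "f differentiable (at x)"
  shows "g differentiable (at x)" "frechet_derivative g (at x) = frechet_derivative f (at x)"
proof -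
  have "(g has_derivative frechet_derivative f (at x)) (at x)"
    using assms by (metis has_derivative_transform_within_open frechet_derivative_works)
  then show "g differentiable (at x)" "frechet_derivative g (at x) = frechet_derivative f (at x)"
    by (auto simp: differentiable_def intro: frechet_derivative_eqI)
qed

lemma Ck_on_cong:
  assumes "open S" "\<And>x. x \<in> S \<Longrightarrow> f x = g x" "Ck_on k S f"
  shows "Ck_on k S g"
  using assms(2,3)
proof (induction k arbitrary: f g)
  case 0 then show ?case by (auto cong: continuous_on_cong)
next
  case (Suc k)
  have "Ck_on k S (\<lambda>x. frechet_derivative g (at x) v)" for v
  proof (rule Suc.IH)
    show "Ck_on k S (\<lambda>x. frechet_derivative f (at x) v)" using Suc.prems by simp
    show "frechet_derivative f (at x) v = frechet_derivative g (at x) v" if "x \<in> S" for x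
      using frechet_derivative_cong_open(2)[OF assms(1) that, of f g] Suc.prems that by simp
  qed
  moreover have "g differentiable (at x)" if "x \<in> S" for x
    using frechet_derivative_cong_open(1)[OF assms(1) that, of f g] Suc.prems that by simp
  ultimately show ?case by simp
qed

lemma Ck_on_subset: "Ck_on k S f \<Longrightarrow> T \<subseteq> S \<Longrightarrow> Ck_on k T f"
  by (induction k arbitrary: f) (auto intro: continuous_on_subset)

lemma Ck_on_local:
  assumes "\<And>x. x \<in> S \<Longrightarrow> \<exists>T. open T \<and> x \<in> T \<and> Ck_on k T f"
  shows "Ck_on k S f"
  using assms
proof (induction k arbitrary: f)
  case 0
  then show ?case
    by (metis Ck_on.simps(1) continuous_at_imp_continuous_on continuous_on_eq_continuous_at)
next
  case (Suc k)
  have "Ck_on k S (\<lambda>x. frechet_derivative f (at x) v)" for v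
    by (rule Suc.IH) (use Suc.prems in fastforce)
  with Suc.prems show ?case by fastforce
qed

lemma Ck_on_SucI:
  assumes "\<And>x. x \<in> S \<Longrightarrow> (f has_derivative f' x) (at x)" "open S" "\<And>v. Ck_on k S (\<lambda>x. f' x v)"
  shows "Ck_on (Suc k) S f"
proof -
  have "Ck_on k S (\<lambda>x. frechet_derivative f (at x) v)" for v
    by (rule Ck_on_cong[OF assms(2) _ assms(3)[of v]]) (simp add: frechet_derivative_eqI[OF assms(1)])
  with assms(1) show ?thesis by (auto simp: differentiable_def)
qed

lemma Ck_on_SucD:
  assumes "Ck_on (Suc k) S f"
  shows "\<And>x. x \<in> S \<Longrightarrow> (f has_derivative frechet_derivative f (at x)) (at x)"
    and "\<And>v. Ck_on k S (\<lambda>x. frechet_derivative f (at x) v)"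
  using assms by (auto simp: frechet_derivative_works[symmetric])

lemma Ck_on_Suc_imp: "Ck_on (Suc k) S f \<Longrightarrow> Ck_on k S f"
proof (induction k arbitrary: f)
  case 0
  then show ?case
    by (auto intro!: continuous_at_imp_continuous_on dest: differentiable_imp_continuous_within)
qed auto

lemma Ck_on_const: "Ck_on k S (\<lambda>x. c)"
proof (induction k arbitrary: c)
  case (Suc k)
  then show ?case by (simp add: frechet_derivative_eqI[OF has_derivative_const])
qed simp

lemma Ck_on_add:
  assumes "open S" "Ck_on k S f" "Ck_on k S g"
  shows "Ck_on k S (\<lambda>x. f x + g x)"
  using assms(2,3)
proof (induction k arbitrary: f g)
  case (Suc k)
  show ?case
    by (rule Ck_on_SucI[OF _ assms(1)])
      (auto intro!: has_derivative_add Ck_on_SucD[OF Suc.prems(1)] Ck_on_SucD[OF Suc.prems(2)]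
        Suc.IH)
qed (auto intro: continuous_on_add)

lemma Ck_on_sum:
  assumes "open S" "\<And>i. i \<in> I \<Longrightarrow> Ck_on k S (f i)"
  shows "Ck_on k S (\<lambda>x. \<Sum>i\<in>I. f i x)"
  using assms(2)
  by (induction I rule: infinite_finite_induct) (auto intro!: Ck_on_const Ck_on_add[OF assms(1)])

lemma Ck_on_bounded_linear:
  assumes "open S" "bounded_linear L" "Ck_on k S f"
  shows "Ck_on k S (\<lambda>x. L (f x))"
  using assms(3)
proof (induction k arbitrary: f)
  case 0
  then show ?case using assms(2) by (simp add: linear_continuous_on_compose bounded_linear.continuous_on)
next
  case (Suc k)
  show ?case
    by (rule Ck_on_SucI[OF _ assms(1)])
      (auto intro!: bounded_linear.has_derivative[OF assms(2)] Ck_on_SucD[OF Suc.prems] Suc.IH)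
qed

lemma Ck_on_scaleR:
  assumes "open S" "Ck_on k S f" "Ck_on k S g"
  shows "Ck_on k S (\<lambda>x. f x *\<^sub>R g x)"
  using assms(2,3)
proof (induction k arbitrary: f g)
  case (Suc k)
  show ?case
  proof (rule Ck_on_SucI[OF _ assms(1)])
    show "((\<lambda>x. f x *\<^sub>R g x) has_derivative
        (\<lambda>v. f x *\<^sub>R frechet_derivative g (at x) v + frechet_derivative f (at x) v *\<^sub>R g x)) (at x)"
      if "x \<in> S" for x
      using that by (intro has_derivative_scaleR Ck_on_SucD[OF Suc.prems(1)] Ck_on_SucD[OF Suc.prems(2)])
    show "Ck_on k S (\<lambda>x. f x *\<^sub>R frechet_derivative g (at x) v
        + frechet_derivative f (at x) v *\<^sub>R g x)" for v
      by (intro Ck_on_add[OF assms(1)] Suc.IH Suc.prems[THEN Ck_on_Suc_imp] Suc.prems[THEN Ck_on_SucD(2)])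
  qed
qed (auto intro: continuous_on_scaleR)

text \<open>The differential of a composition is expanded in the standard basis, so that it becomes a
  finite sum of products of functions covered by the induction hypothesis.\<close>

lemma Ck_on_compose:
  fixes g :: "'a::euclidean_space \<Rightarrow> 'b::euclidean_space"
  assumes "open S" "open T" "g ` S \<subseteq> T" "Ck_on k T f" "Ck_on k S g"
  shows "Ck_on k S (\<lambda>x. f (g x))"
  using assms(4,5)
proof (induction k arbitrary: f)
  case 0
  then show ?case using assms(3) by (auto intro: continuous_on_compose2)
next
  case (Suc k)
  note Df = Ck_on_SucD[OF Suc.prems(1)] and Dg = Ck_on_SucD[OF Suc.prems(2)]
  let ?Df = "\<lambda>y. frechet_derivative f (at y)" and ?Dg = "\<lambda>x. frechet_derivative g (at x)"
  show ?case
  proof (rule Ck_on_SucI[OF _ assms(1)])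
    fix x assume x: "x \<in> S"
    with assms(3) have "g x \<in> T" by auto
    then have lin: "linear (?Df (g x))" using Df(1) has_derivative_linear by blast
    have D: "?Df (g x) (?Dg x v) = (\<Sum>b\<in>Basis. (?Dg x v \<bullet> b) *\<^sub>R ?Df (g x) b)" for v
    proof -
      have "?Df (g x) (?Dg x v) = ?Df (g x) (\<Sum>b\<in>Basis. (?Dg x v \<bullet> b) *\<^sub>R b)"
        by (simp add: euclidean_representation)
      then show ?thesis by (simp add: linear_sum[OF lin] linear_scale[OF lin])
    qed
    show "((\<lambda>x. f (g x)) has_derivative (\<lambda>v. \<Sum>b\<in>Basis. (?Dg x v \<bullet> b) *\<^sub>R ?Df (g x) b)) (at x)"
      using has_derivative_compose[OF Dg(1)[OF x] Df(1)[OF \<open>g x \<in> T\<close>]] unfolding D .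
  next
    fix v
    have "Ck_on k S (\<lambda>x. ?Dg x v \<bullet> b)" for b
      using Ck_on_bounded_linear[OF assms(1) bounded_linear_inner_left Dg(2)] .
    moreover have "Ck_on k S (\<lambda>x. ?Df (g x) b)" for b
      using Suc.IH[OF Df(2) Ck_on_Suc_imp[OF Suc.prems(2)]] .
    ultimately show "Ck_on k S (\<lambda>x. \<Sum>b\<in>Basis. (?Dg x v \<bullet> b) *\<^sub>R ?Df (g x) b)"
      by (intro Ck_on_sum Ck_on_scaleR assms(1)) auto
  qed
qed

lemma smooth_on_cong: "open S \<Longrightarrow> (\<And>x. x \<in> S \<Longrightarrow> f x = g x) \<Longrightarrow> smooth_on S f \<Longrightarrow> smooth_on S g"
  unfolding smooth_on_def using Ck_on_cong by blast

lemma smooth_on_subset: "smooth_on S f \<Longrightarrow> T \<subseteq> S \<Longrightarrow> smooth_on T f"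
  unfolding smooth_on_def using Ck_on_subset by blast

lemma smooth_on_local:
  assumes "\<And>x. x \<in> S \<Longrightarrow> \<exists>T. open T \<and> x \<in> T \<and> smooth_on T f"
  shows "smooth_on S f"
  unfolding smooth_on_def
proof
  show "Ck_on k S f" for k
    by (rule Ck_on_local) (use assms in \<open>auto simp: smooth_on_def\<close>)
qed

lemma smooth_on_const: "smooth_on S (\<lambda>x. c)"
  by (simp add: smooth_on_def Ck_on_const)

lemma smooth_on_add:
  "open S \<Longrightarrow> smooth_on S f \<Longrightarrow> smooth_on S g \<Longrightarrow> smooth_on S (\<lambda>x. f x + g x)"
  by (simp add: smooth_on_def Ck_on_add)

lemma smooth_on_mult:
  "open S \<Longrightarrow> smooth_on S f \<Longrightarrow> smooth_on S g \<Longrightarrow> smooth_on S (\<lambda>x. f x * g x :: real)"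
  using Ck_on_scaleR[of S _ f g] by (simp add: smooth_on_def)

lemma smooth_on_compose:
  fixes g :: "'a::euclidean_space \<Rightarrow> 'b::euclidean_space"
  assumes "open S" "open T" "g ` S \<subseteq> T" "smooth_on T f" "smooth_on S g"
  shows "smooth_on S (\<lambda>x. f (g x))"
  using assms(4,5) unfolding smooth_on_def by (auto intro: Ck_on_compose[OF assms(1-3)])

lemma smooth_on_affine:
  assumes "open S" "bounded_linear L"
  shows "smooth_on S (\<lambda>x. c + L x)"
  unfolding smooth_on_def
proof
  fix k
  have "Ck_on (Suc k) S (\<lambda>x. c + L x)"
    by (rule Ck_on_SucI[where f' = "\<lambda>_. L"])
      (auto intro!: derivative_eq_intros bounded_linear_imp_has_derivative assms Ck_on_const)
  then show "Ck_on k S (\<lambda>x. c + L x)" by (rule Ck_on_Suc_imp)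
qed

lemma smooth_on_differentiable: "smooth_on S f \<Longrightarrow> x \<in> S \<Longrightarrow> f differentiable (at x)"
  unfolding smooth_on_def by (metis Ck_on.simps(2))

lemma smooth_on_derivative:
  "smooth_on S f \<Longrightarrow> smooth_on S (\<lambda>x. frechet_derivative f (at x) v)"
  unfolding smooth_on_def by (metis Ck_on.simps(2))

section \<open>Charts, smooth functions and tangent vectors\<close>

text \<open>Smoothness in charts and tangent vectors make sense for any covering family of charts; charts
  and covering pass to products directly. Compatible charts are considered in \<open>manifold\<close>.\<close>

locale atlas =
  fixes A :: "('m::topological_space, 'e::euclidean_space) chart set"
  assumes is_chart: "(U, \<phi>) \<in> A \<Longrightarrow> is_chart (U, \<phi>)"
    and chart_at: "\<exists>U \<phi>. (U, \<phi>) \<in> A \<and> p \<in> U"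
begin

lemma chart_open: "(U, \<phi>) \<in> A \<Longrightarrow> open U"
  using is_chart by (auto simp: is_chart_def)

lemma chart_inv [simp]: "(U, \<phi>) \<in> A \<Longrightarrow> p \<in> U \<Longrightarrow> inv_into U \<phi> (\<phi> p) = p"
  using is_chart by (fastforce simp: is_chart_def homeomorphism_def)

lemma open_chart_image:
  assumes "(U, \<phi>) \<in> A" "open W"
  shows "open (\<phi> ` (U \<inter> W))"
proof -
  have "homeomorphism U (\<phi> ` U) \<phi> (inv_into U \<phi>)" "open (\<phi> ` U)"
    using is_chart[OF assms(1)] by (auto simp: is_chart_def)
  then have "open (\<phi> ` U \<inter> inv_into U \<phi> -` W)"
    using assms(2) by (auto simp: homeomorphism_def intro: continuous_open_preimage)
  moreover have "\<phi> ` (U \<inter> W) = \<phi> ` U \<inter> inv_into U \<phi> -` W"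
    using assms(1) by auto
  ultimately show ?thesis by simp
qed

lemma smooth_fun_subset: "smooth_fun A W f \<Longrightarrow> W' \<subseteq> W \<Longrightarrow> smooth_fun A W' f"
  unfolding smooth_fun_def
  by (auto 4 4 intro: smooth_on_subset)

lemma smooth_fun_const: "smooth_fun A W (\<lambda>p. c)"
  by (auto simp: smooth_fun_def o_def smooth_on_const)

lemma smooth_fun_add:
  "open W \<Longrightarrow> smooth_fun A W f \<Longrightarrow> smooth_fun A W h \<Longrightarrow> smooth_fun A W (\<lambda>p. f p + h p)"
  unfolding smooth_fun_def o_def by (auto intro!: smooth_on_add open_chart_image)

lemma smooth_fun_mult:
  "open W \<Longrightarrow> smooth_fun A W f \<Longrightarrow> smooth_fun A W h \<Longrightarrow> smooth_fun A W (\<lambda>p. f p * h p)"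
  unfolding smooth_fun_def o_def by (auto intro!: smooth_on_mult open_chart_image)

lemma smooth_atI: "smooth_fun A W f \<Longrightarrow> open W \<Longrightarrow> p \<in> W \<Longrightarrow> smooth_at A p f"
  by (auto simp: smooth_at_def)

lemma differentiable_in_chart:
  assumes "smooth_at A p f" "(U, \<phi>) \<in> A" "p \<in> U"
  shows "(f \<circ> inv_into U \<phi>) differentiable (at (\<phi> p))"
proof -
  obtain W where "open W" "p \<in> W" "smooth_fun A W f" using assms(1) by (auto simp: smooth_at_def)
  then show ?thesis
    using assms(2,3) by (intro smooth_on_differentiable[of "\<phi> ` (U \<inter> W)"]) (auto simp: smooth_fun_def)
qed

end

text \<open>The tangent vector at \<open>p\<close> with components \<open>u\<close> in the chart \<open>c\<close>.\<close>

definition coord_deriv ::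
    "('m::topological_space, 'e::euclidean_space) chart set \<Rightarrow> ('m, 'e) chart \<Rightarrow> 'm \<Rightarrow> 'e \<Rightarrow> 'm tvec"
  where "coord_deriv A c p u =
    (\<lambda>f. if smooth_at A p f
         then frechet_derivative (f \<circ> inv_into (fst c) (snd c)) (at (snd c p)) u else 0)"

lemma tangent_space_alt:
  "tangent_space A p = {coord_deriv A (U, \<phi>) p u |U \<phi> u. (U, \<phi>) \<in> A \<and> p \<in> U}"
  unfolding tangent_space_def coord_deriv_def fst_conv snd_conv by blast

lemma tangent_vector_not_smooth: "v \<in> tangent_space A p \<Longrightarrow> \<not> smooth_at A p f \<Longrightarrow> v f = 0"
  by (auto simp: tangent_space_def)

locale atlas_map = source: atlas A + target: atlas B
  for A :: "('m::topological_space, 'd::euclidean_space) chart set"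
    and B :: "('n::topological_space, 'e::euclidean_space) chart set" +
  fixes F :: "'m \<Rightarrow> 'n"
  assumes smooth: "smooth_map A B F"
begin

lemma open_vimage: "open W \<Longrightarrow> open (F -` W)"
  using smooth by (simp add: smooth_map_def open_vimage)

text \<open>Locally \<open>F\<close> takes values in a single chart of the target, where \<open>f \<circ> F\<close> is a composition of
  smooth maps between Euclidean spaces.\<close>

lemma smooth_fun_comp:
  assumes "open W" "smooth_fun B W f"
  shows "smooth_fun A (F -` W) (f \<circ> F)"
  unfolding smooth_fun_def
proof clarify
  fix U \<phi> assume U: "(U, \<phi>) \<in> A"
  show "smooth_on (\<phi> ` (U \<inter> F -` W)) (f \<circ> F \<circ> inv_into U \<phi>)"
  proof (rule smooth_on_local)
    fix x assume "x \<in> \<phi> ` (U \<inter> F -` W)"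
    then obtain p where p: "p \<in> U" "F p \<in> W" "x = \<phi> p" by auto
    obtain V \<psi> where V: "(V, \<psi>) \<in> B" "F p \<in> V" using target.chart_at by blast
    let ?T = "\<phi> ` (U \<inter> F -` (V \<inter> W))"
    let ?G = "\<psi> \<circ> F \<circ> inv_into U \<phi>"
    have T: "open ?T"
      using U V assms(1) target.chart_open by (intro source.open_chart_image open_vimage) auto
    have "smooth_on (\<phi> ` (U \<inter> F -` V)) ?G" using smooth U V by (fastforce simp: smooth_map_def)
    then have G: "smooth_on ?T ?G" by (rule smooth_on_subset) auto
    have f: "smooth_on (\<psi> ` (V \<inter> W)) (f \<circ> inv_into V \<psi>)"
      using assms V by (auto simp: smooth_fun_def)
    have "smooth_on ?T (\<lambda>y. (f \<circ> inv_into V \<psi>) (?G y))"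
      by (rule smooth_on_compose[OF T _ _ f G])
        (use U V assms(1) in \<open>auto intro: target.open_chart_image\<close>)
    then have "smooth_on ?T (f \<circ> F \<circ> inv_into U \<phi>)"
      by (rule smooth_on_cong[OF T, rotated]) (use U V in auto)
    then show "\<exists>T. open T \<and> x \<in> T \<and> smooth_on T (f \<circ> F \<circ> inv_into U \<phi>)"
      using T p V by blast
  qed
qed

lemma smooth_at_comp:
  assumes "smooth_at B (F p) f"
  shows "smooth_at A p (f \<circ> F)"
  using assms smooth_fun_comp open_vimage unfolding smooth_at_def by blast

text \<open>Near \<open>p\<close> the function \<open>f \<circ> F\<close> read in \<open>(U, \<phi>)\<close> is the composition of \<open>f\<close> read in \<open>(V, \<psi>)\<close>
  with \<open>F\<close> read in both charts, so this is the chain rule. It is stated for arbitrary charts so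
  that the identity map yields the change of charts.\<close>

lemma push_forward_coord_deriv:
  assumes "(U, \<phi>) \<in> A" "p \<in> U" "(V, \<psi>) \<in> B" "F p \<in> V"
  shows "push_forward A B F p (coord_deriv A (U, \<phi>) p u) =
    coord_deriv B (V, \<psi>) (F p) (frechet_derivative (\<psi> \<circ> F \<circ> inv_into U \<phi>) (at (\<phi> p)) u)"
proof
  fix f :: "'n \<Rightarrow> real"
  let ?G = "\<psi> \<circ> F \<circ> inv_into U \<phi>" and ?f = "f \<circ> inv_into V \<psi>"
  show "push_forward A B F p (coord_deriv A (U, \<phi>) p u) f =
    coord_deriv B (V, \<psi>) (F p) (frechet_derivative ?G (at (\<phi> p)) u) f"
  proof (cases "smooth_at B (F p) f")
    case True
    let ?T = "\<phi> ` (U \<inter> F -` V)"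
    have T: "open ?T" "\<phi> p \<in> ?T"
      using assms target.chart_open by (auto intro!: source.open_chart_image open_vimage)
    have "smooth_on ?T ?G" using smooth assms by (fastforce simp: smooth_map_def)
    then have "?G differentiable (at (\<phi> p))" using T smooth_on_differentiable by blast
    then have G: "(?G has_derivative frechet_derivative ?G (at (\<phi> p))) (at (\<phi> p))"
      by (simp add: frechet_derivative_works)
    have "?f differentiable (at (?G (\<phi> p)))"
      using target.differentiable_in_chart[OF True assms(3,4)] assms by simp
    then have f: "(?f has_derivative frechet_derivative ?f (at (\<psi> (F p)))) (at (?G (\<phi> p)))"
      using assms by (simp add: frechet_derivative_works)
    have "((f \<circ> F \<circ> inv_into U \<phi>) has_derivative
        (frechet_derivative ?f (at (\<psi> (F p))) \<circ> frechet_derivative ?G (at (\<phi> p)))) (at (\<phi> p))"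
      by (rule has_derivative_transform_within_open[OF diff_chain_at[OF G f] T])
        (use assms in auto)
    then have "frechet_derivative (f \<circ> F \<circ> inv_into U \<phi>) (at (\<phi> p)) =
        frechet_derivative ?f (at (\<psi> (F p))) \<circ> frechet_derivative ?G (at (\<phi> p))"
      by (rule frechet_derivative_eqI)
    then show ?thesis
      using True smooth_at_comp by (simp add: push_forward_def coord_deriv_def)
  qed (simp add: push_forward_def coord_deriv_def)
qed

lemma push_forward_tangent:
  assumes "v \<in> tangent_space A p"
  shows "push_forward A B F p v \<in> tangent_space B (F p)"
proof -
  obtain V \<psi> where V: "(V, \<psi>) \<in> B" "F p \<in> V" using target.chart_at by blast
  then show ?thesis
    using assms push_forward_coord_deriv[OF _ _ V] by (force simp: tangent_space_alt)
qed

end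

lemma push_forward_add: "push_forward A B F p (u + v) = push_forward A B F p u + push_forward A B F p v"
  by (auto simp: push_forward_def)

lemma push_forward_scale: "push_forward A B F p (c \<star> v) = c \<star> push_forward A B F p v"
  by (auto simp: push_forward_def tscale_def)

lemma push_forward_id:
  "v \<in> tangent_space A p \<Longrightarrow> push_forward A A (\<lambda>q. q) p v = v"
  by (auto simp: push_forward_def tangent_vector_not_smooth o_def)

lemma tscale_apply: "(c \<star> v) f = c * v f"
  by (simp add: tscale_def)

lemma zero_tscale [simp]: "0 \<star> v = 0"
  by (auto simp: tscale_def)

locale manifold =
  fixes A :: "('m::{t2_space, second_countable_topology}, 'e::euclidean_space) chart set"
  assumes smooth_manifold: "smooth_manifold A"

sublocale manifold \<subseteq> atlas A
proof
  show "(U, \<phi>) \<in> A \<Longrightarrow> is_chart (U, \<phi>)" for U \<phi>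
    using smooth_manifold by (auto simp: smooth_manifold_def)
  show "\<exists>U \<phi>. (U, \<phi>) \<in> A \<and> p \<in> U" for p
  proof -
    have "p \<in> (\<Union>(U, \<phi>)\<in>A. U)" using smooth_manifold by (simp add: smooth_manifold_def)
    then show ?thesis by auto
  qed
qed

context manifold
begin

lemma smooth_map_id: "smooth_map A A (\<lambda>q. q)"
proof -
  have "smooth_on (\<phi> ` (U \<inter> V)) (\<psi> \<circ> inv_into U \<phi>)" if "(U, \<phi>) \<in> A" "(V, \<psi>) \<in> A" for U \<phi> V \<psi>
    using smooth_manifold that by (fastforce simp: smooth_manifold_def)
  then show ?thesis by (auto simp: smooth_map_def o_def)
qed

text \<open>A single chart gives all tangent vectors: a change of charts is the coordinate expression of
  the identity map, whose push-forward fixes every tangent vector.\<close>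

lemma tangent_space_in_chart:
  assumes "(U, \<phi>) \<in> A" "p \<in> U"
  shows "tangent_space A p = range (coord_deriv A (U, \<phi>) p)"
proof
  interpret ident: atlas_map A A "\<lambda>q. q"
    by unfold_locales (rule smooth_map_id)
  show "tangent_space A p \<subseteq> range (coord_deriv A (U, \<phi>) p)"
  proof
    fix v assume v: "v \<in> tangent_space A p"
    then obtain V \<psi> u where "(V, \<psi>) \<in> A" "p \<in> V" "v = coord_deriv A (V, \<psi>) p u"
      by (auto simp: tangent_space_alt)
    then show "v \<in> range (coord_deriv A (U, \<phi>) p)"
      using ident.push_forward_coord_deriv[of V \<psi> p U \<phi> u] assms push_forward_id[OF v]
      by (metis rangeI)
  qed
  show "range (coord_deriv A (U, \<phi>) p) \<subseteq> tangent_space A p"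
    using assms by (auto simp: tangent_space_alt)
qed

lemma coord_deriv_linear:
  assumes "(U, \<phi>) \<in> A" "p \<in> U"
  shows "coord_deriv A (U, \<phi>) p (x + y) = coord_deriv A (U, \<phi>) p x + coord_deriv A (U, \<phi>) p y"
    and "coord_deriv A (U, \<phi>) p (c *\<^sub>R x) = c \<star> coord_deriv A (U, \<phi>) p x"
proof -
  have lin: "linear (frechet_derivative (f \<circ> inv_into U \<phi>) (at (\<phi> p)))" if "smooth_at A p f" for f
    using differentiable_in_chart[OF that assms] frechet_derivative_works has_derivative_linear by blast
  show "coord_deriv A (U, \<phi>) p (x + y) = coord_deriv A (U, \<phi>) p x + coord_deriv A (U, \<phi>) p y"
    by (auto simp: coord_deriv_def linear_add[OF lin])
  show "coord_deriv A (U, \<phi>) p (c *\<^sub>R x) = c \<star> coord_deriv A (U, \<phi>) p x"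
    by (auto simp: coord_deriv_def tscale_def linear_scale[OF lin])
qed

lemma tangent_add:
  assumes "u \<in> tangent_space A p" "v \<in> tangent_space A p"
  shows "u + v \<in> tangent_space A p"
proof -
  obtain U \<phi> where U: "(U, \<phi>) \<in> A" "p \<in> U" using chart_at by blast
  then show ?thesis
    using assms by (auto simp: tangent_space_in_chart[OF U] coord_deriv_linear(1)[OF U, symmetric])
qed

lemma tangent_scale:
  assumes "v \<in> tangent_space A p"
  shows "c \<star> v \<in> tangent_space A p"
proof -
  obtain U \<phi> where U: "(U, \<phi>) \<in> A" "p \<in> U" using chart_at by blast
  then show ?thesis
    using assms by (auto simp: tangent_space_in_chart[OF U] coord_deriv_linear(2)[OF U, symmetric])
qed

lemma tangent_vector_const: "v \<in> tangent_space A p \<Longrightarrow> v (\<lambda>q. c) = 0"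
  by (auto simp: tangent_space_def o_def frechet_derivative_eqI[OF has_derivative_const])

lemma vector_field_tangent: "X \<in> vector_fields A \<Longrightarrow> X p \<in> tangent_space A p"
  by (simp add: vector_fields_def)

lemma vector_field_add:
  "X \<in> vector_fields A \<Longrightarrow> Y \<in> vector_fields A \<Longrightarrow> X + Y \<in> vector_fields A"
  by (auto simp: vector_fields_def tangent_add intro!: smooth_fun_add)

lemma vector_field_fscale:
  "X \<in> vector_fields A \<Longrightarrow> smooth_fun A UNIV h \<Longrightarrow> fscale h X \<in> vector_fields A"
  by (auto simp: vector_fields_def tangent_scale fscale_def tscale_apply
      intro!: smooth_fun_mult smooth_fun_subset[of UNIV h])

lemma vector_field_smooth:
  "X \<in> vector_fields A \<Longrightarrow> smooth_fun A UNIV h \<Longrightarrow> smooth_fun A UNIV (\<lambda>p. X p h)"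
  by (simp add: vector_fields_def)

lemma diff_conv_fscale: "X - Y = X + fscale (\<lambda>_. - 1) Y" for X Y :: "'m vfield"
  by (intro ext) (simp add: fscale_def tscale_def)

lemma vector_field_diff:
  "X \<in> vector_fields A \<Longrightarrow> Y \<in> vector_fields A \<Longrightarrow> X - Y \<in> vector_fields A"
  unfolding diff_conv_fscale
  by (intro vector_field_add vector_field_fscale smooth_fun_const)

end


section \<open>Left translations and left-invariant fields\<close>

lemma inv_into_map_prod:
  assumes "\<And>x. x \<in> U \<Longrightarrow> inv_into U \<phi> (\<phi> x) = x" "\<And>y. y \<in> V \<Longrightarrow> inv_into V \<psi> (\<psi> y) = y"
    and "x \<in> U" "y \<in> V"
  shows "inv_into (U \<times> V) (map_prod \<phi> \<psi>) (\<phi> x, \<psi> y) = (x, y)"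
proof -
  have "inj_on (map_prod \<phi> \<psi>) (U \<times> V)"
    by (rule inj_onI) (metis (no_types, lifting) assms(1,2) map_prod_simp mem_Sigma_iff
        prod.inject surj_pair)
  then show ?thesis using assms inv_into_f_f[of "map_prod \<phi> \<psi>" "U \<times> V" "(x, y)"] by simp
qed

text \<open>The inverse of a product coordinate map is the product of the inverses on the coordinate image;
  this gives its continuity.\<close>

lemma is_chart_prod:
  assumes "is_chart (U, \<phi>)" "is_chart (V, \<psi>)"
  shows "is_chart (U \<times> V, map_prod \<phi> \<psi>)"
proof -
  have U: "open U" "open (\<phi> ` U)" "homeomorphism U (\<phi> ` U) \<phi> (inv_into U \<phi>)"
    and V: "open V" "open (\<psi> ` V)" "homeomorphism V (\<psi> ` V) \<psi> (inv_into V \<psi>)"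
    using assms by (auto simp: is_chart_def)
  have img: "map_prod \<phi> \<psi> ` (U \<times> V) = \<phi> ` U \<times> \<psi> ` V" by (simp add: map_prod_surj_on)
  have inv: "inv_into (U \<times> V) (map_prod \<phi> \<psi>) (\<phi> x, \<psi> y) = (x, y)" if "x \<in> U" "y \<in> V" for x y
    using U(3) V(3) that by (intro inv_into_map_prod) (auto simp: homeomorphism_def)
  have "continuous_on (U \<times> V) (\<lambda>z. (\<phi> (fst z), \<psi> (snd z)))"
    using U(3) V(3) unfolding homeomorphism_def
    by (intro continuous_on_Pair continuous_on_compose2[OF _ continuous_on_fst[OF continuous_on_id]]
        continuous_on_compose2[OF _ continuous_on_snd[OF continuous_on_id]]) auto
  then have cont: "continuous_on (U \<times> V) (map_prod \<phi> \<psi>)" by (simp add: map_prod_def case_prod_unfold)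
  have "continuous_on (\<phi> ` U \<times> \<psi> ` V) (\<lambda>z. (inv_into U \<phi> (fst z), inv_into V \<psi> (snd z)))"
    using U(3) V(3) unfolding homeomorphism_def
    by (intro continuous_on_Pair continuous_on_compose2[OF _ continuous_on_fst[OF continuous_on_id]]
        continuous_on_compose2[OF _ continuous_on_snd[OF continuous_on_id]]) auto
  moreover have "(inv_into U \<phi> (fst z), inv_into V \<psi> (snd z)) = inv_into (U \<times> V) (map_prod \<phi> \<psi>) z"
    if "z \<in> \<phi> ` U \<times> \<psi> ` V" for z
    using that inv U(3) V(3) by (auto simp: homeomorphism_def)
  ultimately have cont': "continuous_on (\<phi> ` U \<times> \<psi> ` V) (inv_into (U \<times> V) (map_prod \<phi> \<psi>))"
    by (simp cong: continuous_on_cong)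
  have "homeomorphism (U \<times> V) (\<phi> ` U \<times> \<psi> ` V) (map_prod \<phi> \<psi>) (inv_into (U \<times> V) (map_prod \<phi> \<psi>))"
    by (rule homeomorphismI[OF cont cont']) (use inv in auto)
  then show ?thesis using U V by (simp add: is_chart_def img open_Times)
qed

lemma atlas_prod:
  assumes "atlas A" "atlas B"
  shows "atlas (prod_atlas A B)"
proof
  interpret A: atlas A by fact
  interpret B: atlas B by fact
  show "(W, \<theta>) \<in> prod_atlas A B \<Longrightarrow> is_chart (W, \<theta>)" for W \<theta>
    using A.is_chart B.is_chart is_chart_prod by (fastforce simp: prod_atlas_def)
  show "\<exists>W \<theta>. (W, \<theta>) \<in> prod_atlas A B \<and> p \<in> W" for p
  proof -
    obtain U \<phi> where "(U, \<phi>) \<in> A" "fst p \<in> U" using A.chart_at by blast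
    moreover obtain V \<psi> where "(V, \<psi>) \<in> B" "snd p \<in> V" using B.chart_at by blast
    ultimately have "(U \<times> V, map_prod \<phi> \<psi>) \<in> prod_atlas A B \<and> p \<in> U \<times> V"
      by (auto simp: prod_atlas_def mem_Times_iff)
    then show ?thesis by blast
  qed
qed

locale lie_group_manifold = manifold A
  for A :: "('g::{t2_space, second_countable_topology, group_add}, 'e::euclidean_space) chart set" +
  assumes smooth_mult: "smooth_map (prod_atlas A A) A (\<lambda>(x, y). x + y)"
begin

sublocale mult: atlas_map "prod_atlas A A" A "\<lambda>(x, y). x + y"
proof -
  interpret P: atlas "prod_atlas A A" by (rule atlas_prod) unfold_locales
  show "atlas_map (prod_atlas A A) A (\<lambda>(x, y). x + y)" by unfold_locales (rule smooth_mult)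
qed

text \<open>In coordinates a left translation is the multiplication restricted to a slice, that is,
  precomposed with an affine map \<open>x \<mapsto> (const, x)\<close>.\<close>

lemma smooth_left_translation: "smooth_map A A ((+) a)"
  unfolding smooth_map_def
proof (intro conjI ballI; clarify?)
  have "continuous_on UNIV (\<lambda>(x, y). x + y :: 'g)" using smooth_mult by (simp add: smooth_map_def)
  then have "continuous_on UNIV (\<lambda>y. case (a, y) of (x, y) \<Rightarrow> x + y)"
    by (rule continuous_on_compose2) (auto intro!: continuous_intros)
  then show "continuous_on UNIV ((+) a)" by simp
next
  fix U \<phi> V \<psi> assume U: "(U, \<phi>) \<in> A" and V: "(V, \<psi>) \<in> A"
  obtain U' \<phi>' where U': "(U', \<phi>') \<in> A" "a \<in> U'" using chart_at by blast
  let ?S = "\<phi> ` (U \<inter> (+) a -` V)"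
  let ?T = "map_prod \<phi>' \<phi> ` (U' \<times> U \<inter> (\<lambda>(x, y). x + y) -` V)"
  let ?G = "\<psi> \<circ> (\<lambda>(x, y). x + y) \<circ> inv_into (U' \<times> U) (map_prod \<phi>' \<phi>)"
  have c: "(U' \<times> U, map_prod \<phi>' \<phi>) \<in> prod_atlas A A" using U U' by (auto simp: prod_atlas_def)
  have G: "smooth_on ?T ?G" using smooth_mult c V by (fastforce simp: smooth_map_def)
  have T: "open ?T"
    using c V chart_open by (intro mult.source.open_chart_image mult.open_vimage) auto
  have cont: "continuous_on UNIV (\<lambda>x. (\<phi>' a, x :: 'e))" by (intro continuous_intros)
  have "?S = (\<lambda>x. (\<phi>' a, x)) -` ?T"
  proof (intro equalityI subsetI)
    fix x assume "x \<in> (\<lambda>x. (\<phi>' a, x)) -` ?T"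
    then obtain p q where pq: "p \<in> U'" "q \<in> U" "p + q \<in> V" "\<phi>' a = \<phi>' p" "x = \<phi> q" by auto
    then have "p = a" using U' chart_inv by metis
    with pq show "x \<in> ?S" by auto
  qed (use U' in auto)
  then have S: "open ?S" using T cont by (simp add: open_vimage)
  have "smooth_on ?S (\<lambda>x. (\<phi>' a, 0) + (0, x))"
    by (rule smooth_on_affine[OF S])
      (simp add: bounded_linear_Pair bounded_linear_zero bounded_linear_ident)
  then have aff: "smooth_on ?S (\<lambda>x. (\<phi>' a, x))" by simp
  have "smooth_on ?S (\<lambda>x. ?G (\<phi>' a, x))"
    by (rule smooth_on_compose[OF S T _ G aff]) (use U' in auto)
  then show "smooth_on ?S (\<psi> \<circ> (+) a \<circ> inv_into U \<phi>)"
    by (rule smooth_on_cong[OF S, rotated]) (use U U' in \<open>auto simp: inv_into_map_prod\<close>)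
qed

sublocale trans: atlas_map A A "(+) a" for a
  by unfold_locales (rule smooth_left_translation)

abbreviation translate :: "'g \<Rightarrow> 'g \<Rightarrow> 'g tvec \<Rightarrow> 'g tvec"
  where "translate a \<equiv> push_forward A A ((+) a)"

lemma translate_translate:
  "translate a (b + p) (translate b p v) = translate (a + b) p v"
proof
  fix f :: "'g \<Rightarrow> real"
  have "f \<circ> (+) a \<circ> (+) b = f \<circ> (+) (a + b)" by (auto simp: add.assoc)
  then show "translate a (b + p) (translate b p v) f = translate (a + b) p v f"
    using trans.smooth_at_comp[of a "b + p" f] by (simp add: push_forward_def add.assoc)
qed

lemma translate_zero: "v \<in> tangent_space A p \<Longrightarrow> translate 0 p v = v"
proof -
  assume "v \<in> tangent_space A p"
  moreover have "(+) (0 :: 'g) = (\<lambda>q. q)" by auto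
  ultimately show ?thesis by (simp add: push_forward_id)
qed

lemma smooth_at_translate: "smooth_at A p (f \<circ> (+) a) \<longleftrightarrow> smooth_at A (a + p) f"
proof
  assume "smooth_at A p (f \<circ> (+) a)"
  then have "smooth_at A (- a + (a + p)) (f \<circ> (+) a)" by (simp add: add.assoc[symmetric])
  then have "smooth_at A (a + p) (f \<circ> (+) a \<circ> (+) (- a))" by (rule trans.smooth_at_comp)
  moreover have "f \<circ> (+) a \<circ> (+) (- a) = f" by (auto simp: add.assoc[symmetric])
  ultimately show "smooth_at A (a + p) f" by simp
qed (rule trans.smooth_at_comp)

abbreviation left_inv :: "'g tvec \<Rightarrow> 'g vfield"
  where "left_inv \<equiv> left_inv_field A"

lemma left_inv_at_identity: "v \<in> tangent_space A 0 \<Longrightarrow> left_inv v 0 = v"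
  by (simp add: left_inv_field_def translate_zero)

lemma left_inv_shift: "left_inv v (a + p) = translate a p (left_inv v p)"
  using translate_translate[of a p 0 v] by (simp add: left_inv_field_def)

lemma left_inv_tangent: "v \<in> tangent_space A 0 \<Longrightarrow> left_inv v p \<in> tangent_space A p"
  using trans.push_forward_tangent[of v 0 p] by (simp add: left_inv_field_def)

text \<open>For \<open>f\<close> smooth at \<open>a + p\<close> this is left-invariance. Otherwise both sides are 0: the inverse
  translation is smooth, so \<open>f \<circ> (+) a\<close> cannot be smooth at \<open>p\<close>.\<close>

lemma left_inv_apply_shift:
  assumes "v \<in> tangent_space A 0"
  shows "left_inv v (a + p) f = left_inv v p (f \<circ> (+) a)"
  using tangent_vector_not_smooth[OF left_inv_tangent[OF assms]] smooth_at_translate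
  by (simp add: left_inv_shift push_forward_def)

lemma left_inv_add: "left_inv (u + v) = left_inv u + left_inv v"
  by (auto simp: left_inv_field_def push_forward_add)

lemma left_inv_scale: "left_inv (c \<star> v) p = c \<star> left_inv v p"
  by (auto simp: left_inv_field_def push_forward_scale)

text \<open>In coordinates a left-invariant field applied to a function is the partial derivative of
  \<open>(x, y) \<mapsto> f (x + y)\<close> in the second argument, evaluated at the identity; smoothness of the
  multiplication makes it depend smoothly on \<open>x\<close>.\<close>

lemma left_inv_smooth:
  assumes "v \<in> tangent_space A 0" "open W" "smooth_fun A W f"
  shows "smooth_fun A W (\<lambda>p. left_inv v p f)"
  unfolding smooth_fun_def
proof clarify
  fix U \<phi> assume U: "(U, \<phi>) \<in> A"
  obtain V \<psi> u where V: "(V, \<psi>) \<in> A" "0 \<in> V" and v: "v = coord_deriv A (V, \<psi>) 0 u"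
    using assms(1) by (auto simp: tangent_space_alt)
  let ?m = "\<lambda>(x, y). x + y :: 'g"
  let ?S = "\<phi> ` (U \<inter> W)"
  let ?T = "map_prod \<phi> \<psi> ` (U \<times> V \<inter> ?m -` W)"
  let ?F = "f \<circ> ?m \<circ> inv_into (U \<times> V) (map_prod \<phi> \<psi>)"
  have c: "(U \<times> V, map_prod \<phi> \<psi>) \<in> prod_atlas A A" using U V by (auto simp: prod_atlas_def)
  have S: "open ?S" using open_chart_image U assms(2) by blast
  have T: "open ?T" using c assms(2) by (intro mult.source.open_chart_image mult.open_vimage) auto
  have F: "smooth_on ?T ?F"
    using mult.smooth_fun_comp[OF assms(2,3)] c by (fastforce simp: smooth_fun_def)
  have "smooth_on ?S (\<lambda>x. (0, \<psi> 0) + (x, 0))"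
    by (rule smooth_on_affine[OF S])
      (simp add: bounded_linear_Pair bounded_linear_zero bounded_linear_ident)
  then have aff: "smooth_on ?S (\<lambda>x. (x, \<psi> 0))" by simp
  have img: "(\<lambda>x. (x, \<psi> 0)) ` ?S \<subseteq> ?T"
    using V by (force simp: image_iff)
  have "smooth_on ?S (\<lambda>x. frechet_derivative ?F (at (x, \<psi> 0)) (0, u))"
    by (rule smooth_on_compose[OF S T img smooth_on_derivative[OF F] aff])
  then show "smooth_on ?S ((\<lambda>p. left_inv v p f) \<circ> inv_into U \<phi>)"
  proof (rule smooth_on_cong[OF S, rotated])
    fix x assume "x \<in> ?S"
    then obtain p where p: "p \<in> U" "p \<in> W" "x = \<phi> p" by auto
    have fp: "smooth_at A p f" using smooth_atI assms p by blast
    let ?h = "f \<circ> (+) p \<circ> inv_into V \<psi>"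
    have "(x, \<psi> 0) \<in> ?T" using p V by (force simp: image_iff)
    then have "(?F has_derivative frechet_derivative ?F (at (x, \<psi> 0))) (at (x, \<psi> 0))"
      using smooth_on_differentiable[OF F] by (simp add: frechet_derivative_works)
    moreover have "((\<lambda>y. (x, y)) has_derivative (\<lambda>y. (0, y))) (at (\<psi> 0))"
      by (auto intro!: derivative_eq_intros)
    ultimately have "((\<lambda>y. ?F (x, y)) has_derivative
        (\<lambda>y. frechet_derivative ?F (at (x, \<psi> 0)) (0, y))) (at (\<psi> 0))"
      by (rule has_derivative_compose[rotated])
    moreover have "open (\<psi> ` V)" using open_chart_image[OF V(1) open_UNIV] by simp
    ultimately have "(?h has_derivative
        (\<lambda>y. frechet_derivative ?F (at (x, \<psi> 0)) (0, y))) (at (\<psi> 0))"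
      by (rule has_derivative_transform_within_open)
        (use U V p in \<open>auto simp: inv_into_map_prod\<close>)
    then have "frechet_derivative ?h (at (\<psi> 0)) u = frechet_derivative ?F (at (x, \<psi> 0)) (0, u)"
      by (simp add: frechet_derivative_eqI)
    moreover have "smooth_at A 0 (f \<circ> (+) p)" using fp by (simp add: smooth_at_translate)
    ultimately show "frechet_derivative ?F (at (x, \<psi> 0)) (0, u)
        = ((\<lambda>p. left_inv v p f) \<circ> inv_into U \<phi>) x"
      using fp U p v by (simp add: left_inv_field_def push_forward_def coord_deriv_def)
  qed
qed

lemma left_inv_vector_field: "v \<in> tangent_space A 0 \<Longrightarrow> left_inv v \<in> vector_fields A"
  using left_inv_smooth left_inv_tangent by (auto simp: vector_fields_def)

text \<open>Left-invariant fields commute with composition with a left translation, hence so do the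
  iterated derivatives that make up the bracket.\<close>

lemma bracket_left_inv:
  assumes "v \<in> tangent_space A 0" "w \<in> tangent_space A 0"
  shows "bracket A (left_inv v) (left_inv w) = left_inv (lie_bracket A v w)"
proof (intro ext)
  fix a and f :: "'g \<Rightarrow> real"
  have "left_inv u a (\<lambda>q. left_inv u' q f) = left_inv u 0 (\<lambda>q. left_inv u' q (f \<circ> (+) a))"
    if "u \<in> tangent_space A 0" "u' \<in> tangent_space A 0" for u u'
    using left_inv_apply_shift[OF that(1), of a 0 "\<lambda>q. left_inv u' q f"]
    by (simp add: o_def left_inv_apply_shift[OF that(2)])
  moreover have "lie_bracket A v w (f \<circ> (+) a) =
      left_inv v 0 (\<lambda>q. left_inv w q (f \<circ> (+) a)) - left_inv w 0 (\<lambda>q. left_inv v q (f \<circ> (+) a))"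
    if "smooth_at A a f"
    using smooth_at_translate[of 0 f a] that by (simp add: bracket_def lie_bracket_def)
  moreover have "left_inv (lie_bracket A v w) a f =
      (if smooth_at A a f then lie_bracket A v w (f \<circ> (+) a) else 0)"
    by (simp add: left_inv_field_def[of A "lie_bracket A v w"] push_forward_def)
  ultimately show "bracket A (left_inv v) (left_inv w) a f = left_inv (lie_bracket A v w) a f"
    using assms by (simp add: bracket_def)
qed

end

section \<open>Orthonormal bases and left-invariant frames\<close>

lemma sum_tvec_apply: "(\<Sum>i\<in>I. F i) x = (\<Sum>i\<in>I. F i x)"
  for F :: "'i \<Rightarrow> 'x \<Rightarrow> 'y::comm_monoid_add"
  by (induction I rule: infinite_finite_induct) auto

text \<open>Finite-dimensional linear algebra on spaces of operators, which carry no scalar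
  multiplication other than the explicit operation \<open>\<star>\<close>.\<close>

locale inner_subspace =
  fixes T :: "'m tvec set" and ip :: "'m tvec \<Rightarrow> 'm tvec \<Rightarrow> real"
  assumes nonempty: "T \<noteq> {}"
    and add: "u \<in> T \<Longrightarrow> v \<in> T \<Longrightarrow> u + v \<in> T"
    and scale: "u \<in> T \<Longrightarrow> c \<star> u \<in> T"
    and ip_add_left: "u \<in> T \<Longrightarrow> v \<in> T \<Longrightarrow> w \<in> T \<Longrightarrow> ip (u + v) w = ip u w + ip v w"
    and ip_scale_left: "u \<in> T \<Longrightarrow> w \<in> T \<Longrightarrow> ip (c \<star> u) w = c * ip u w"
    and ip_sym: "u \<in> T \<Longrightarrow> v \<in> T \<Longrightarrow> ip u v = ip v u"
    and ip_pos: "u \<in> T \<Longrightarrow> u \<noteq> 0 \<Longrightarrow> ip u u > 0"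
begin

lemma zero: "0 \<in> T"
proof -
  obtain u where "u \<in> T" using nonempty by auto
  then have "0 \<star> u \<in> T" by (rule scale)
  then show ?thesis by simp
qed

lemma ip_zero_left: "w \<in> T \<Longrightarrow> ip 0 w = 0"
  using ip_scale_left[OF zero, of w 0] by simp

lemma diff_conv: "u - v = u + (- 1) \<star> v" for u v :: "'m tvec"
  by (auto simp: tscale_def)

lemma diff: "u \<in> T \<Longrightarrow> v \<in> T \<Longrightarrow> u - v \<in> T"
  unfolding diff_conv by (intro add scale)

lemma ip_diff_left: "u \<in> T \<Longrightarrow> v \<in> T \<Longrightarrow> w \<in> T \<Longrightarrow> ip (u - v) w = ip u w - ip v w"
  unfolding diff_conv by (simp add: ip_add_left ip_scale_left scale)

lemma ip_add_right: "u \<in> T \<Longrightarrow> v \<in> T \<Longrightarrow> w \<in> T \<Longrightarrow> ip w (u + v) = ip w u + ip w v"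
  using ip_add_left ip_sym add by metis

lemma ip_scale_right: "u \<in> T \<Longrightarrow> w \<in> T \<Longrightarrow> ip w (c \<star> u) = c * ip w u"
  using ip_scale_left ip_sym scale by metis

lemma ip_diff_right: "u \<in> T \<Longrightarrow> v \<in> T \<Longrightarrow> w \<in> T \<Longrightarrow> ip w (u - v) = ip w u - ip w v"
  using ip_diff_left ip_sym diff by metis

lemma sum: "(\<And>i. i \<in> I \<Longrightarrow> f i \<in> T) \<Longrightarrow> (\<Sum>i\<in>I. f i) \<in> T"
  by (induction I rule: infinite_finite_induct) (auto intro: zero add)

lemma ip_sum_left:
  "w \<in> T \<Longrightarrow> (\<And>i. i \<in> I \<Longrightarrow> f i \<in> T) \<Longrightarrow> ip (\<Sum>i\<in>I. f i) w = (\<Sum>i\<in>I. ip (f i) w)"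
  by (induction I rule: infinite_finite_induct) (auto simp: ip_zero_left ip_add_left sum)

lemma ip_eqI:
  assumes "u \<in> T" "v \<in> T" "\<And>w. w \<in> T \<Longrightarrow> ip u w = ip v w"
  shows "u = v"
proof -
  have "ip (u - v) (u - v) = 0" using assms by (simp add: ip_diff_left diff)
  then have "u - v = 0" using ip_pos[of "u - v"] assms diff by force
  then show ?thesis by simp
qed

definition orthonormal :: "'m tvec set \<Rightarrow> bool" where
  "orthonormal E \<longleftrightarrow> finite E \<and> E \<subseteq> T \<and> (\<forall>e\<in>E. \<forall>e'\<in>E. ip e e' = (if e = e' then 1 else 0))"

text \<open>The orthogonal projection onto the span of an orthonormal set \<open>E\<close>; that \<open>E\<close> spans the space is
  expressed by \<open>expand E x = x\<close>.\<close>

definition expand :: "'m tvec set \<Rightarrow> 'm tvec \<Rightarrow> 'm tvec" where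
  "expand E x = (\<Sum>e\<in>E. ip x e \<star> e)"

lemma expand_in: "orthonormal E \<Longrightarrow> x \<in> T \<Longrightarrow> expand E x \<in> T"
  by (auto simp: expand_def orthonormal_def intro!: sum scale)

lemma ip_expand: "orthonormal E \<Longrightarrow> x \<in> T \<Longrightarrow> y \<in> T \<Longrightarrow> ip (expand E x) y = (\<Sum>e\<in>E. ip x e * ip e y)"
  unfolding expand_def orthonormal_def
  by (subst ip_sum_left) (auto intro!: scale sum.cong simp: ip_scale_left subset_iff)

lemma ip_expand_member:
  assumes "orthonormal E" "x \<in> T" "e \<in> E"
  shows "ip (expand E x) e = ip x e"
proof -
  have "ip (expand E x) e = (\<Sum>e'\<in>E. ip x e' * ip e' e)"
    using assms by (intro ip_expand) (auto simp: orthonormal_def)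
  also have "\<dots> = (\<Sum>e'\<in>E. if e' = e then ip x e else 0)"
    using assms by (intro sum.cong) (auto simp: orthonormal_def)
  also have "\<dots> = ip x e"
    using assms by (simp add: orthonormal_def)
  finally show ?thesis .
qed

text \<open>One step of the Gram--Schmidt process: the normalized component of \<open>x\<close> orthogonal to the span
  of \<open>E\<close> is added, unless it vanishes.\<close>

lemma gram_schmidt_step:
  assumes E: "orthonormal E" and x: "x \<in> T"
  obtains E' where "orthonormal E'" "expand E' x = x"
    "\<And>y. y \<in> T \<Longrightarrow> expand E y = y \<Longrightarrow> expand E' y = y"
proof (cases "expand E x = x")
  case True
  then show ?thesis using that E by blast
next
  case False
  define r where "r = x - expand E x"
  define n where "n = (1 / sqrt (ip r r)) \<star> r"
  have ET: "e \<in> T" if "e \<in> E" for e using E that by (auto simp: orthonormal_def)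
  have r: "r \<in> T" "r \<noteq> 0" using False x E by (auto simp: r_def intro: diff expand_in)
  then have pos: "ip r r > 0" by (rule ip_pos)
  have n: "n \<in> T" using r by (simp add: n_def scale)
  have re: "ip r e = 0" if "e \<in> E" for e
    using ip_expand_member[OF E x that] x ET[OF that] expand_in[OF E x] by (simp add: r_def ip_diff_left)
  then have ne': "ip n e = 0" if "e \<in> E" for e
    using that r ET by (simp add: n_def ip_scale_left)
  then have ne: "ip e n = 0" if "e \<in> E" for e
    using that ip_sym[OF n ET] by simp
  have nn: "ip n n = 1" using pos r n by (simp add: n_def ip_scale_left ip_scale_right scale)
  then have nE: "n \<notin> E" using ne' by force
  have exp: "expand (insert n E) y = ip y n \<star> n + expand E y" for y
    using nE E by (simp add: expand_def orthonormal_def)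
  show ?thesis
  proof (rule that)
    show "orthonormal (insert n E)" using E n nn ne ne' nE by (auto simp: orthonormal_def)
    have "ip (expand E x) n = 0" using ne E x n by (simp add: ip_expand)
    then have "ip x n = ip r n" using x n E by (simp add: r_def ip_diff_left expand_in)
    also have "\<dots> = sqrt (ip r r)"
      using r pos by (simp add: n_def ip_scale_right real_div_sqrt)
    finally have "ip x n \<star> n = r" using pos by (auto simp: n_def tscale_def)
    then show "expand (insert n E) x = x" by (simp add: exp r_def)
    fix y assume y: "y \<in> T" "expand E y = y"
    have "ip y n = 0" using ip_expand[OF E y(1) n] y(2) ne by simp
    then show "expand (insert n E) y = y" using y by (simp add: exp)
  qed
qed

lemma gram_schmidt:
  assumes "finite S" "S \<subseteq> T"
  shows "\<exists>E. orthonormal E \<and> (\<forall>x\<in>S. expand E x = x)"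
  using assms
proof (induction S)
  case empty
  have "orthonormal {}" by (simp add: orthonormal_def)
  then show ?case by blast
next
  case (insert x S)
  then obtain E where E: "orthonormal E" "\<forall>x\<in>S. expand E x = x" by auto
  obtain E' where "orthonormal E'" "expand E' x = x"
    "\<And>y. y \<in> T \<Longrightarrow> expand E y = y \<Longrightarrow> expand E' y = y"
    using gram_schmidt_step[OF E(1)] insert.prems by blast
  then show ?case using E(2) insert.prems by blast
qed

text \<open>The projection onto the span of \<open>E\<close> is linear, so if it fixes a spanning family it is the
  identity. Families are used in place of sets because the coordinate vectors that span a tangent
  space are indexed by the standard basis.\<close>

lemma orthonormal_basis_exists:
  assumes "finite I" "\<And>i. i \<in> I \<Longrightarrow> f i \<in> T"
    and span: "\<And>x. x \<in> T \<Longrightarrow> \<exists>c. x = (\<Sum>i\<in>I. c i \<star> f i)"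
  shows "\<exists>E. orthonormal E \<and> (\<forall>x\<in>T. expand E x = x)"
proof -
  obtain E where E: "orthonormal E" "\<forall>i\<in>I. expand E (f i) = f i"
    using gram_schmidt[of "f ` I"] assms by auto
  have "expand E x = x" if x: "x \<in> T" for x
  proof (rule ip_eqI)
    fix w assume w: "w \<in> T"
    obtain c where c: "x = (\<Sum>i\<in>I. c i \<star> f i)" using span x by blast
    have lin: "ip x y = (\<Sum>i\<in>I. c i * ip (f i) y)" if "y \<in> T" for y
      using that assms(2) unfolding c by (subst ip_sum_left) (auto intro: scale simp: ip_scale_left)
    have "ip (expand E x) w = (\<Sum>e\<in>E. \<Sum>i\<in>I. c i * (ip (f i) e * ip e w))"
      using E(1) x w by (auto simp: ip_expand orthonormal_def lin sum_distrib_right mult.assoc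
          subset_iff intro!: sum.cong)
    also have "\<dots> = (\<Sum>i\<in>I. c i * (\<Sum>e\<in>E. ip (f i) e * ip e w))"
      by (subst sum.swap) (simp add: sum_distrib_left)
    also have "\<dots> = ip x w"
      using E assms(2) w lin[OF w] by (auto simp: ip_expand[symmetric] intro!: sum.cong)
    finally show "ip (expand E x) w = ip x w" .
  qed (use E x expand_in in auto)
  with E show ?thesis by blast
qed

text \<open>The vector with components \<open>l e\<close> in an orthonormal basis represents \<open>l\<close>.\<close>

lemma riesz_representation:
  fixes l :: "'m tvec \<Rightarrow> real"
  assumes E: "orthonormal E" "\<And>x. x \<in> T \<Longrightarrow> expand E x = x"
    and add: "\<And>x y. x \<in> T \<Longrightarrow> y \<in> T \<Longrightarrow> l (x + y) = l x + l y"
    and scale: "\<And>c x. x \<in> T \<Longrightarrow> l (c \<star> x) = c * l x"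
  shows "\<exists>!u. u \<in> T \<and> (\<forall>w\<in>T. l w = ip u w)"
proof (rule ex_ex1I)
  have ET: "e \<in> T" if "e \<in> E" for e using E that by (auto simp: orthonormal_def)
  let ?u = "\<Sum>e\<in>E. l e \<star> e"
  have u: "?u \<in> T" using ET by (intro sum inner_subspace.scale[OF inner_subspace_axioms])
  have l0: "l 0 = 0" using scale[OF zero, of 0] by simp
  have lsum: "l (\<Sum>e\<in>F. c e \<star> e) = (\<Sum>e\<in>F. c e * l e)" if "finite F" "F \<subseteq> T"
    for F :: "'m tvec set" and c :: "'m tvec \<Rightarrow> real"
    using that
  proof (induction F)
    case empty
    show ?case using l0 by (simp del: zero_fun_apply)
  next
    case (insert x F)
    then show ?case
      by (simp add: add scale sum subset_iff inner_subspace.scale[OF inner_subspace_axioms]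
          del: plus_fun_apply)
  qed
  have "l w = ip ?u w" if w: "w \<in> T" for w
  proof -
    have "l w = l (expand E w)" using E w by simp
    also have "\<dots> = (\<Sum>e\<in>E. ip w e * l e)"
      using E(1) unfolding expand_def by (intro lsum) (auto simp: orthonormal_def)
    also have "\<dots> = ip ?u w"
      using w ET by (subst ip_sum_left)
        (auto intro!: sum.cong inner_subspace.scale[OF inner_subspace_axioms] simp: ip_scale_left ip_sym)
    finally show ?thesis .
  qed
  with u show "\<exists>u. u \<in> T \<and> (\<forall>w\<in>T. l w = ip u w)" by blast
  show "u = u'" if "u \<in> T \<and> (\<forall>w\<in>T. l w = ip u w)" "u' \<in> T \<and> (\<forall>w\<in>T. l w = ip u' w)" for u u'
    by (rule ip_eqI) (use that in auto)
qed

end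

locale riemannian_manifold = manifold A
  for A :: "('m::{t2_space, second_countable_topology}, 'e::euclidean_space) chart set" +
  fixes g :: "'m tensor2"
  assumes riemannian_metric: "riemannian_metric A g"
begin

sublocale tangent: inner_subspace "tangent_space A p" "g p" for p
proof
  show "tangent_space A p \<noteq> {}" using chart_at by (fastforce simp: tangent_space_alt)
qed (use riemannian_metric in \<open>auto simp: riemannian_metric_def smooth_tensor2_def tangent_add tangent_scale\<close>)

lemma orthonormal_basis:
  obtains E where "tangent.orthonormal p E" "\<And>x. x \<in> tangent_space A p \<Longrightarrow> tangent.expand p E x = x"
proof -
  obtain U \<phi> where U: "(U, \<phi>) \<in> A" "p \<in> U" using chart_at by blast
  let ?D = "coord_deriv A (U, \<phi>) p"
  have "\<exists>E. tangent.orthonormal p E \<and> (\<forall>x\<in>tangent_space A p. tangent.expand p E x = x)"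
  proof (rule tangent.orthonormal_basis_exists)
    show "finite (Basis :: 'e set)" by simp
    show "?D b \<in> tangent_space A p" for b using tangent_space_in_chart[OF U] by simp
    fix x assume "x \<in> tangent_space A p"
    then obtain u where x: "x = ?D u" using tangent_space_in_chart[OF U] by auto
    have D0: "?D 0 = 0" using coord_deriv_linear(1)[OF U, of 0 0] by simp
    have "?D (\<Sum>b\<in>B. (u \<bullet> b) *\<^sub>R b) = (\<Sum>b\<in>B. (u \<bullet> b) \<star> ?D b)" if "finite B" for B
      using that
      by induction (simp_all only: sum.empty sum.insert D0 coord_deriv_linear[OF U] not_False_eq_True)
    from this[OF finite_Basis] have "x = (\<Sum>b\<in>Basis. (u \<bullet> b) \<star> ?D b)"
      unfolding x euclidean_representation .
    then show "\<exists>c. x = (\<Sum>b\<in>Basis. c b \<star> ?D b)" by (rule exI[of _ "\<lambda>b. u \<bullet> b"])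
  qed
  then show ?thesis using that by blast
qed

text \<open>This is what makes the definite descriptions defining the Lorentz force and the adjoint of
  \<open>ad\<close> meaningful.\<close>

lemma riesz:
  assumes "\<And>x y. x \<in> tangent_space A p \<Longrightarrow> y \<in> tangent_space A p \<Longrightarrow> l (x + y) = l x + l y"
    and "\<And>c x. x \<in> tangent_space A p \<Longrightarrow> l (c \<star> x) = c * l x"
  shows "\<exists>!u. u \<in> tangent_space A p \<and> (\<forall>w\<in>tangent_space A p. l w = g p u w)"
proof -
  obtain E where E: "tangent.orthonormal p E"
    "\<And>x. x \<in> tangent_space A p \<Longrightarrow> tangent.expand p E x = x" using orthonormal_basis[of p] by blast
  show ?thesis by (rule tangent.riesz_representation[OF E assms])
qed

lemma smooth_metric:
  "X \<in> vector_fields A \<Longrightarrow> Y \<in> vector_fields A \<Longrightarrow> smooth_fun A UNIV (\<lambda>p. g p (X p) (Y p))"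
  using riemannian_metric by (simp add: riemannian_metric_def smooth_tensor2_def)

end

locale lie_group_metric = lie_group_manifold A + riemannian_manifold A g
  for A :: "('g::{t2_space, second_countable_topology, group_add}, 'e::euclidean_space) chart set"
    and g :: "'g tensor2" +
  assumes left_invariant_metric: "left_invariant A g"
begin

lemma metric_translate:
  "u \<in> tangent_space A p \<Longrightarrow> v \<in> tangent_space A p \<Longrightarrow>
    g (a + p) (translate a p u) (translate a p v) = g p u v"
  using left_invariant_metric by (simp add: left_invariant_def)

lemma metric_left_inv:
  "u \<in> tangent_space A 0 \<Longrightarrow> v \<in> tangent_space A 0 \<Longrightarrow> g p (left_inv u p) (left_inv v p) = g 0 u v"
  using metric_translate[of u 0 v p] by (simp add: left_inv_field_def)

lemma translate_to_identity:
  assumes "x \<in> tangent_space A p"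
  obtains y where "y \<in> tangent_space A 0" "x = left_inv y p"
proof
  show "translate (- p) p x \<in> tangent_space A 0" using trans.push_forward_tangent[OF assms, of "- p"] by simp
  show "x = left_inv (translate (- p) p x) p"
    using translate_translate[of p "- p" p x] translate_zero[OF assms] by (simp add: left_inv_field_def)
qed

lemma left_inv_sum: "left_inv (\<Sum>i\<in>I. c i \<star> v i) p = (\<Sum>i\<in>I. c i \<star> left_inv (v i) p)"
proof -
  have "left_inv 0 p = 0" by (auto simp: left_inv_field_def push_forward_def)
  then show ?thesis
    by (induction I rule: infinite_finite_induct) (auto simp: left_inv_add left_inv_scale)
qed

text \<open>The coefficients are inner products with the frame fields, so those of a smooth vector field are
  smooth functions, by smoothness of the metric.\<close>

definition frame :: "'g tvec set \<Rightarrow> bool" where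
  "frame E \<longleftrightarrow> finite E \<and> E \<subseteq> tangent_space A 0 \<and>
    (\<forall>p. \<forall>x\<in>tangent_space A p. x = (\<Sum>e\<in>E. g p x (left_inv e p) \<star> left_inv e p))"

text \<open>Left translations are isometries and every tangent vector is the translate of one at the
  identity, so an orthonormal basis there is transported to every point.\<close>

lemma frame_exists: "\<exists>E. frame E"
proof -
  obtain E where E: "tangent.orthonormal 0 E"
    "\<And>x. x \<in> tangent_space A 0 \<Longrightarrow> tangent.expand 0 E x = x" using orthonormal_basis[of 0] by blast
  then have ET: "e \<in> tangent_space A 0" if "e \<in> E" for e
    using that by (auto simp: tangent.orthonormal_def)
  have "x = (\<Sum>e\<in>E. g p x (left_inv e p) \<star> left_inv e p)" if x: "x \<in> tangent_space A p" for p x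
  proof -
    obtain y where y: "y \<in> tangent_space A 0" "x = left_inv y p" using translate_to_identity[OF x] .
    have "x = left_inv (\<Sum>e\<in>E. g 0 y e \<star> e) p" using E(2)[OF y(1)] y(2) by (simp add: tangent.expand_def)
    also have "\<dots> = (\<Sum>e\<in>E. g 0 y e \<star> left_inv e p)" by (rule left_inv_sum)
    also have "\<dots> = (\<Sum>e\<in>E. g p x (left_inv e p) \<star> left_inv e p)"
      using ET y by (auto simp: metric_left_inv intro!: sum.cong)
    finally show ?thesis .
  qed
  then have "frame E" using E(1) ET by (auto simp: frame_def tangent.orthonormal_def)
  then show ?thesis ..
qed

lemma vector_field_sum:
  assumes "finite I" "\<And>i. i \<in> I \<Longrightarrow> F i \<in> vector_fields A"
  shows "(\<Sum>i\<in>I. F i) \<in> vector_fields A"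
  using assms
proof (induction I)
  case empty
  have "fscale (\<lambda>_. 0) (left_inv v) \<in> vector_fields A" if "v \<in> tangent_space A 0" for v
    using that by (intro vector_field_fscale left_inv_vector_field smooth_fun_const)
  moreover have "fscale (\<lambda>_. 0) X = (0 :: 'g vfield)" for X
    by (intro ext) (simp add: fscale_def tscale_def)
  ultimately have "0 \<in> vector_fields A" using tangent.zero by metis
  then show ?case unfolding sum.empty .
qed (simp add: vector_field_add)

text \<open>The global frame replaces the usual argument with cut-off functions: \<open>S X\<close> is computed from the
  coefficients of \<open>X\<close> in the frame, and only their values at \<open>p\<close> remain.\<close>

lemma tensorial_pointwise:
  fixes S :: "'g vfield \<Rightarrow> 'g tvec"
  assumes X: "X \<in> vector_fields A" and X': "X' \<in> vector_fields A" and eq: "X p = X' p"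
    and S_add: "\<And>X Y. X \<in> vector_fields A \<Longrightarrow> Y \<in> vector_fields A \<Longrightarrow> S (X + Y) = S X + S Y"
    and S_scale: "\<And>h X. X \<in> vector_fields A \<Longrightarrow> smooth_fun A UNIV h \<Longrightarrow> S (fscale h X) = h p \<star> S X"
  shows "S X = S X'"
proof -
  obtain E where E: "frame E" using frame_exists by blast
  have EV: "left_inv e \<in> vector_fields A" if "e \<in> E" for e
    using E that by (auto simp: frame_def intro: left_inv_vector_field)
  have fin: "finite E" using E by (simp add: frame_def)
  have "S X = (\<Sum>e\<in>E. g p (X p) (left_inv e p) \<star> S (left_inv e))" if X: "X \<in> vector_fields A" for X
  proof -
    let ?h = "\<lambda>e q. g q (X q) (left_inv e q)"
    let ?F = "\<lambda>e. fscale (?h e) (left_inv e)"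
    have h: "smooth_fun A UNIV (?h e)" if "e \<in> E" for e using smooth_metric X EV that by blast
    have XE: "X = (\<Sum>e\<in>E. ?F e)"
    proof
      fix q
      show "X q = (\<Sum>e\<in>E. ?F e) q"
        using E vector_field_tangent[OF X, of q] by (simp add: frame_def sum_tvec_apply fscale_def)
    qed
    have S_sum: "S (\<Sum>e\<in>F. ?F e) = (\<Sum>e\<in>F. S (?F e))" if "F \<subseteq> E" for F
    proof -
      have "finite F" using fin that finite_subset by blast
      then show ?thesis using that
      proof (induction F)
        case empty
        have "0 \<in> vector_fields A"
          by (rule vector_field_sum[of "{}", unfolded sum.empty]) auto
        from S_add[OF this this] have "S 0 = 0" by simp
        then show ?case unfolding sum.empty .
      next
        case (insert e F)
        then show ?case
          by (subst sum.insert, simp, simp, subst S_add)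
            (auto intro!: vector_field_sum vector_field_fscale h EV)
      qed
    qed
    have "S X = (\<Sum>e\<in>E. S (?F e))"
      using arg_cong[OF XE, of S] S_sum[OF order_refl] by (rule trans)
    also have "\<dots> = (\<Sum>e\<in>E. g p (X p) (left_inv e p) \<star> S (left_inv e))"
      by (intro sum.cong refl S_scale EV h)
    finally show ?thesis .
  qed
  from this[OF X] this[OF X'] eq show ?thesis by simp
qed

end

section \<open>The Levi-Civita connection and its curvature\<close>

lemma fscale_diff: "fscale h (X - Y) = fscale h X - fscale h Y"
  and fscale_diff_coeff: "fscale (\<lambda>p. h p - k p) X = fscale h X - fscale k X"
  by (intro ext; simp add: fscale_def tscale_def algebra_simps)+

lemma fscale_apply: "fscale h X p = h p \<star> X p"
  by (simp add: fscale_def)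

locale lie_group_connection = lie_group_metric A g
  for A :: "('g::{t2_space, second_countable_topology, group_add}, 'e::euclidean_space) chart set"
    and g :: "'g tensor2" +
  fixes nabla :: "'g vfield \<Rightarrow> 'g vfield \<Rightarrow> 'g vfield"
  assumes levi_civita: "levi_civita A g nabla"
begin

abbreviation VF :: "'g vfield set" where "VF \<equiv> vector_fields A"

lemma nabla_VF [intro]: "X \<in> VF \<Longrightarrow> Y \<in> VF \<Longrightarrow> nabla X Y \<in> VF"
  and nabla_add_left: "X \<in> VF \<Longrightarrow> Y \<in> VF \<Longrightarrow> Z \<in> VF \<Longrightarrow> nabla (X + Y) Z = nabla X Z + nabla Y Z"
  and nabla_add_right: "X \<in> VF \<Longrightarrow> Y \<in> VF \<Longrightarrow> Z \<in> VF \<Longrightarrow> nabla X (Y + Z) = nabla X Y + nabla X Z"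
  and nabla_fscale_left:
    "X \<in> VF \<Longrightarrow> Y \<in> VF \<Longrightarrow> smooth_fun A UNIV h \<Longrightarrow> nabla (fscale h X) Y = fscale h (nabla X Y)"
  and nabla_fscale_right:
    "X \<in> VF \<Longrightarrow> Y \<in> VF \<Longrightarrow> smooth_fun A UNIV h \<Longrightarrow>
      nabla X (fscale h Y) = fscale (\<lambda>p. X p h) Y + fscale h (nabla X Y)"
  and torsion_free: "X \<in> VF \<Longrightarrow> Y \<in> VF \<Longrightarrow> bracket A X Y = nabla X Y - nabla Y X"
  and metric_compatible:
    "X \<in> VF \<Longrightarrow> Y \<in> VF \<Longrightarrow> Z \<in> VF \<Longrightarrow>
      X p (\<lambda>q. g q (Y q) (Z q)) = g p (nabla X Y p) (Z p) + g p (Y p) (nabla X Z p)"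
  using levi_civita by (simp_all add: levi_civita_def affine_connection_def)

lemma nabla_diff_left:
  assumes "X \<in> VF" "Y \<in> VF" "Z \<in> VF"
  shows "nabla (X - Y) Z = nabla X Z - nabla Y Z"
  using nabla_add_left[of "X - Y" Y Z] assms by (simp add: vector_field_diff)

text \<open>Torsion-freeness expresses the bracket by the connection, so it is a vector field without an
  appeal to the symmetry of second derivatives.\<close>

lemma bracket_VF [intro]: "X \<in> VF \<Longrightarrow> Y \<in> VF \<Longrightarrow> bracket A X Y \<in> VF"
  by (simp add: torsion_free nabla_VF vector_field_diff)

lemma bracket_fscale_left:
  assumes "X \<in> VF" "Y \<in> VF" "smooth_fun A UNIV h"
  shows "bracket A (fscale h X) Y = fscale h (bracket A X Y) - fscale (\<lambda>p. Y p h) X"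
  using assms
  by (simp add: torsion_free vector_field_fscale nabla_fscale_left nabla_fscale_right fscale_diff)

lemma bracket_apply:
  assumes "smooth_fun A UNIV h"
  shows "(\<lambda>p. bracket A X Y p h) = (\<lambda>p. X p (\<lambda>q. Y q h) - Y p (\<lambda>q. X q h))"
  using smooth_atI[OF assms open_UNIV] by (simp add: bracket_def)

text \<open>The curvature on vector fields, before evaluation at a point.\<close>

definition curv :: "'g vfield \<Rightarrow> 'g vfield \<Rightarrow> 'g vfield \<Rightarrow> 'g vfield" where
  "curv X Y Z = nabla X (nabla Y Z) - nabla Y (nabla X Z) - nabla (bracket A X Y) Z"

lemma curv_add_left:
  assumes "X \<in> VF" "X' \<in> VF" "Y \<in> VF" "Z \<in> VF"
  shows "curv (X + X') Y Z = curv X Y Z + curv X' Y Z"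
proof -
  have "bracket A (X + X') Y = bracket A X Y + bracket A X' Y"
    using assms by (simp add: torsion_free vector_field_add nabla_add_left nabla_add_right)
  then show ?thesis
    using assms by (simp add: curv_def nabla_add_left nabla_add_right nabla_VF bracket_VF)
qed

lemma curv_fscale_left:
  assumes "X \<in> VF" "Y \<in> VF" "Z \<in> VF" "smooth_fun A UNIV h"
  shows "curv (fscale h X) Y Z = fscale h (curv X Y Z)"
  using assms
  by (simp add: curv_def bracket_fscale_left nabla_fscale_left nabla_fscale_right nabla_diff_left
      nabla_VF bracket_VF vector_field_fscale vector_field_smooth fscale_diff)

lemma curv_antisym:
  assumes "X \<in> VF" "Y \<in> VF" "Z \<in> VF"
  shows "curv X Y Z = - curv Y X Z"
  using assms by (simp add: curv_def torsion_free nabla_diff_left nabla_VF)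

lemma curv_add_right:
  assumes "X \<in> VF" "Y \<in> VF" "Z \<in> VF" "Z' \<in> VF"
  shows "curv X Y (Z + Z') = curv X Y Z + curv X Y Z'"
  using assms by (simp add: curv_def nabla_add_right nabla_VF bracket_VF)

lemma curv_fscale_right:
  assumes "X \<in> VF" "Y \<in> VF" "Z \<in> VF" "smooth_fun A UNIV h"
  shows "curv X Y (fscale h Z) = fscale h (curv X Y Z)"
  using assms
  by (simp add: curv_def nabla_add_right nabla_fscale_right nabla_VF bracket_VF vector_field_fscale
      vector_field_smooth fscale_diff bracket_apply fscale_diff_coeff)

text \<open>The middle argument is reduced to the first one by antisymmetry.\<close>

lemma curv_pointwise:
  assumes VF: "X \<in> VF" "Y \<in> VF" "Z \<in> VF" "X' \<in> VF" "Y' \<in> VF" "Z' \<in> VF"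
    and eq: "X p = X' p" "Y p = Y' p" "Z p = Z' p"
  shows "curv X Y Z p = curv X' Y' Z' p"
proof -
  have left: "curv X Y Z p = curv X' Y Z p"
    if "X \<in> VF" "X' \<in> VF" "Y \<in> VF" "Z \<in> VF" "X p = X' p" for X X' Y Z
    by (rule tensorial_pointwise[where p = p and S = "\<lambda>X. curv X Y Z p"])
      (use that in \<open>simp_all add: curv_add_left curv_fscale_left fscale_apply\<close>)
  have "curv X Y Z p = curv X' Y Z p" by (rule left) fact+
  also have "\<dots> = - curv Y X' Z p" using curv_antisym[OF VF(4,2,3)] by simp
  also have "curv Y X' Z p = curv Y' X' Z p" by (rule left) fact+
  also have "- curv Y' X' Z p = curv X' Y' Z p" using curv_antisym[OF VF(4,5,3)] by simp
  also have "\<dots> = curv X' Y' Z' p"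
    by (rule tensorial_pointwise[where p = p and S = "\<lambda>Z. curv X' Y' Z p"])
      (use VF eq in \<open>simp_all add: curv_add_right curv_fscale_right fscale_apply\<close>)
  finally show ?thesis .
qed

abbreviation lie_algebra :: "'g tvec set" where "lie_algebra \<equiv> tangent_space A 0"
abbreviation br :: "'g tvec \<Rightarrow> 'g tvec \<Rightarrow> 'g tvec" where "br \<equiv> lie_bracket A"
abbreviation ip :: "'g tvec \<Rightarrow> 'g tvec \<Rightarrow> real" where "ip \<equiv> g 0"

text \<open>Left-invariant fields witness that the choice in the extension is from a nonempty set.\<close>

lemma extend_at_identity:
  assumes "v \<in> lie_algebra"
  shows "extend A 0 v \<in> VF" "extend A 0 v 0 = v"
proof -
  have "\<exists>X. X \<in> VF \<and> X 0 = v"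
    using assms left_inv_vector_field left_inv_at_identity by blast
  then have "extend A 0 v \<in> VF \<and> extend A 0 v 0 = v"
    unfolding extend_def by (rule someI_ex)
  then show "extend A 0 v \<in> VF" "extend A 0 v 0 = v" by auto
qed

lemma curvature_at_identity:
  assumes "u \<in> lie_algebra" "v \<in> lie_algebra" "w \<in> lie_algebra"
  shows "curvature_at A nabla 0 u v w = curv (left_inv u) (left_inv v) (left_inv w) 0"
  unfolding curvature_at_def Let_def curv_def[symmetric]
  by (rule curv_pointwise) (use assms in \<open>simp_all add: extend_at_identity left_inv_vector_field left_inv_at_identity\<close>)

text \<open>The Levi-Civita connection restricted to left-invariant fields, as a bilinear operation on the
  Lie algebra.\<close>

definition conn :: "'g tvec \<Rightarrow> 'g tvec \<Rightarrow> 'g tvec" where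
  "conn u v = nabla (left_inv u) (left_inv v) 0"

lemma conn_in [intro, simp]: "u \<in> lie_algebra \<Longrightarrow> v \<in> lie_algebra \<Longrightarrow> conn u v \<in> lie_algebra"
  by (simp add: conn_def vector_field_tangent nabla_VF left_inv_vector_field)

lemma br_eq_conn: "u \<in> lie_algebra \<Longrightarrow> v \<in> lie_algebra \<Longrightarrow> br u v = conn u v - conn v u"
  by (simp add: lie_bracket_def torsion_free left_inv_vector_field conn_def)

lemma br_in [intro, simp]: "u \<in> lie_algebra \<Longrightarrow> v \<in> lie_algebra \<Longrightarrow> br u v \<in> lie_algebra"
  by (simp add: br_eq_conn tangent.diff)

lemma left_inv_scale_field: "left_inv (c \<star> v) = fscale (\<lambda>_. c) (left_inv v)"
  by (auto simp: left_inv_scale fscale_def)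

lemma conn_add_left: "u \<in> lie_algebra \<Longrightarrow> v \<in> lie_algebra \<Longrightarrow> w \<in> lie_algebra \<Longrightarrow>
    conn (u + v) w = conn u w + conn v w"
  and conn_add_right: "u \<in> lie_algebra \<Longrightarrow> v \<in> lie_algebra \<Longrightarrow> w \<in> lie_algebra \<Longrightarrow>
    conn u (v + w) = conn u v + conn u w"
  and conn_scale_left: "u \<in> lie_algebra \<Longrightarrow> v \<in> lie_algebra \<Longrightarrow> conn (c \<star> u) v = c \<star> conn u v"
  by (simp_all add: conn_def left_inv_add left_inv_scale_field nabla_add_left nabla_add_right
      nabla_fscale_left left_inv_vector_field smooth_fun_const fscale_apply)

lemma conn_scale_right:
  assumes "u \<in> lie_algebra" "v \<in> lie_algebra"
  shows "conn u (c \<star> v) = c \<star> conn u v"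
proof -
  have "0 \<star> left_inv v 0 = 0" by (auto simp: tscale_def)
  then show ?thesis
    using assms by (simp add: conn_def left_inv_scale_field nabla_fscale_right left_inv_vector_field
        smooth_fun_const fscale_apply tangent_vector_const[OF left_inv_tangent])
qed

lemma br_add_right: "u \<in> lie_algebra \<Longrightarrow> v \<in> lie_algebra \<Longrightarrow> w \<in> lie_algebra \<Longrightarrow>
    br u (v + w) = br u v + br u w"
  by (simp add: br_eq_conn conn_add_left conn_add_right tangent_add)

lemma br_scale_right: "u \<in> lie_algebra \<Longrightarrow> v \<in> lie_algebra \<Longrightarrow> br u (c \<star> v) = c \<star> br u v"
  by (simp add: br_eq_conn conn_scale_left conn_scale_right tangent_scale)
    (simp add: tscale_def fun_eq_iff algebra_simps)

lemma br_antisym: "u \<in> lie_algebra \<Longrightarrow> v \<in> lie_algebra \<Longrightarrow> br v u = (- 1) \<star> br u v"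
  by (auto simp: br_eq_conn tscale_def)

text \<open>The Koszul formula: the inner products of left-invariant fields are constant, so only the
  bracket terms survive.\<close>

lemma koszul:
  assumes u: "u \<in> lie_algebra" and v: "v \<in> lie_algebra" and w: "w \<in> lie_algebra"
  shows "2 * g p (nabla (left_inv u) (left_inv v) p) (left_inv w p)
    = ip (br u v) w - ip (br v w) u + ip (br w u) v"
proof -
  let ?a = "\<lambda>x y z. g p (nabla (left_inv x) (left_inv y) p) (left_inv z p)"
  have skew: "?a x y z + ?a x z y = 0" if "x \<in> lie_algebra" "y \<in> lie_algebra" "z \<in> lie_algebra" for x y z
  proof -
    have "left_inv x p (\<lambda>q. g q (left_inv y q) (left_inv z q)) = 0"
      using that tangent_vector_const[OF left_inv_tangent] by (simp add: metric_left_inv)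
    moreover have "g p (left_inv y p) (nabla (left_inv x) (left_inv z) p) = ?a x z y"
      using that by (simp add: tangent.ip_sym[of "left_inv y p"] vector_field_tangent nabla_VF
          left_inv_vector_field left_inv_tangent)
    ultimately show ?thesis
      using metric_compatible[of "left_inv x" "left_inv y" "left_inv z" p] that
      by (simp add: left_inv_vector_field)
  qed
  have tors: "ip (br x y) z = ?a x y z - ?a y x z"
    if "x \<in> lie_algebra" "y \<in> lie_algebra" "z \<in> lie_algebra" for x y z
  proof -
    have "ip (br x y) z = g p (left_inv (br x y) p) (left_inv z p)"
      using that by (simp add: metric_left_inv)
    also have "left_inv (br x y) p = nabla (left_inv x) (left_inv y) p - nabla (left_inv y) (left_inv x) p"
      using that by (simp add: bracket_left_inv[symmetric] torsion_free left_inv_vector_field)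
    also have "g p \<dots> (left_inv z p) = ?a x y z - ?a y x z"
      using that by (intro tangent.ip_diff_left)
        (simp_all add: vector_field_tangent nabla_VF left_inv_vector_field left_inv_tangent)
    finally show ?thesis .
  qed
  show ?thesis
    using skew[OF u v w] skew[OF v u w] skew[OF w u v] tors[OF u v w] tors[OF v w u] tors[OF w u v]
    by simp
qed

lemma koszul_identity:
  assumes "u \<in> lie_algebra" "v \<in> lie_algebra" "w \<in> lie_algebra"
  shows "2 * ip (conn u v) w = ip (br u v) w - ip (br v w) u + ip (br w u) v"
  using koszul[of u v w 0] assms by (simp add: conn_def left_inv_at_identity)

text \<open>By the Koszul formula \<open>\<langle>\<nabla>\<^sub>y z, u\<rangle>\<close> is a constant function for left-invariant fields; its
  derivative in the direction \<open>x\<close> vanishes, and metric compatibility moves \<open>\<nabla>\<^sub>x\<close> to \<open>u\<close>.\<close>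

lemma ip_second_derivative:
  assumes "x \<in> lie_algebra" "y \<in> lie_algebra" "z \<in> lie_algebra" "u \<in> lie_algebra"
  shows "ip (nabla (left_inv x) (nabla (left_inv y) (left_inv z)) 0) u = - ip (conn y z) (conn x u)"
proof -
  have "g q (nabla (left_inv y) (left_inv z) q) (left_inv u q) = ip (conn y z) u" for q
    using koszul[of y z u q] koszul_identity[of y z u] assms by simp
  then have "left_inv x 0 (\<lambda>q. g q (nabla (left_inv y) (left_inv z) q) (left_inv u q)) = 0"
    using assms tangent_vector_const[OF left_inv_tangent] by simp
  then show ?thesis
    using metric_compatible[of "left_inv x" "nabla (left_inv y) (left_inv z)" "left_inv u" 0] assms
    by (simp add: nabla_VF left_inv_vector_field left_inv_at_identity conn_def)
qed

lemma ip_curvature: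
  assumes "u \<in> lie_algebra" "v \<in> lie_algebra" "w \<in> lie_algebra" "z \<in> lie_algebra"
  shows "ip (curvature_at A nabla 0 u v w) z =
    ip (conn u w) (conn v z) - ip (conn v w) (conn u z) - ip (conn (br u v) w) z"
proof -
  have "nabla (bracket A (left_inv u) (left_inv v)) (left_inv w) 0 = conn (br u v) w"
    using assms by (simp add: bracket_left_inv conn_def)
  then show ?thesis
    using assms by (simp add: curvature_at_identity curv_def tangent.ip_diff_left tangent.diff
        vector_field_tangent nabla_VF bracket_VF left_inv_vector_field ip_second_derivative)
qed

lemma ad_adjoint:
  assumes x: "x \<in> lie_algebra" and z: "z \<in> lie_algebra"
  shows ad_adjoint_in: "ad_adjoint A g x z \<in> lie_algebra"
    and ip_ad_adjoint: "y \<in> lie_algebra \<Longrightarrow> ip (br x y) z = ip y (ad_adjoint A g x z)"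
proof -
  have "\<exists>!u. u \<in> lie_algebra \<and> (\<forall>y\<in>lie_algebra. ip (br x y) z = ip u y)"
    by (rule riesz) (use x z in \<open>simp_all add: br_add_right br_scale_right tangent.ip_add_left
        tangent.ip_scale_left\<close>)
  then have "\<exists>!u. u \<in> lie_algebra \<and> (\<forall>y\<in>lie_algebra. ip (br x y) z = ip y u)"
    using tangent.ip_sym by (metis (no_types, lifting))
  from theI'[OF this] have "ad_adjoint A g x z \<in> lie_algebra \<and>
      (\<forall>y\<in>lie_algebra. ip (br x y) z = ip y (ad_adjoint A g x z))"
    unfolding ad_adjoint_def .
  then show "ad_adjoint A g x z \<in> lie_algebra"
    "y \<in> lie_algebra \<Longrightarrow> ip (br x y) z = ip y (ad_adjoint A g x z)" by auto
qed

text \<open>Up to sign this is the symmetric part of \<open>conn\<close>; the antisymmetric part is half the bracket.\<close>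

definition B :: "'g tvec \<Rightarrow> 'g tvec \<Rightarrow> 'g tvec" where
  "B x y = (1 / 2) \<star> (ad_adjoint A g x y + ad_adjoint A g y x)"

lemma B_in [intro, simp]: "x \<in> lie_algebra \<Longrightarrow> y \<in> lie_algebra \<Longrightarrow> B x y \<in> lie_algebra"
  by (simp add: B_def tangent_add tangent_scale ad_adjoint_in)

lemma B_sym: "B x y = B y x"
  by (simp add: B_def add.commute)

text \<open>The last two terms of the Koszul formula are the negatives of the inner products of \<open>z\<close> with
  the two adjoints in \<open>B x y\<close>.\<close>

lemma conn_eq:
  assumes x: "x \<in> lie_algebra" and y: "y \<in> lie_algebra"
  shows "conn x y = (1 / 2) \<star> br x y - B x y"
proof (rule tangent.ip_eqI)
  fix z assume z: "z \<in> lie_algebra"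
  have "2 * ip (B x y) z = ip z (ad_adjoint A g x y) + ip z (ad_adjoint A g y x)"
    using x y z by (simp add: B_def tangent.ip_scale_left tangent.ip_add_right tangent_add
        ad_adjoint_in tangent.ip_sym[of _ _ z])
  also have "\<dots> = ip (br x z) y + ip (br y z) x" using x y z by (simp add: ip_ad_adjoint)
  also have "ip (br x z) y = - ip (br z x) y"
    using x y z br_antisym[of z x] by (simp add: tangent.ip_scale_left)
  finally have "2 * ip (B x y) z = - ip (br z x) y + ip (br y z) x" .
  then show "ip (conn x y) z = ip ((1 / 2) \<star> br x y - B x y) z"
    using koszul_identity[OF x y z] x y z
    by (simp add: tangent.ip_diff_left tangent.ip_scale_left tangent_scale)
qed (use x y in \<open>simp_all add: tangent.diff tangent_scale\<close>)

text \<open>The coefficient -3/4 collects -1/4 from \<open>\<langle>\<nabla>\<^sub>w v, \<nabla>\<^sub>v w\<rangle>\<close>, where the brackets enter with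
  opposite signs and the mixed terms with \<open>B\<close> cancel, and -1/2 from the Koszul formula for
  \<open>\<langle>\<nabla>\<^bsub>[w, v]\<^esub> v, w\<rangle>\<close>.\<close>

lemma ip_sectional_curvature:
  assumes v: "v \<in> lie_algebra" and w: "w \<in> lie_algebra"
  shows "ip (curvature_at A nabla 0 w v v) w =
    - 3 / 4 * ip (br v w) (br v w) - 1 / 2 * ip (br (br v w) w) v - 1 / 2 * ip (br v (br v w)) w
    - ip (B v v) (B w w) + ip (B v w) (B v w)"
proof -
  let ?b = "br v w"
  have b: "?b \<in> lie_algebra" using v w by simp
  have "br x x = 0" if "x \<in> lie_algebra" for x using that by (simp add: br_eq_conn)
  then have diag: "conn x x = (- 1) \<star> B x x" if "x \<in> lie_algebra" for x
    using that by (intro ext) (simp add: conn_eq tscale_apply)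
  have c1: "ip (conn v v) (conn w w) = ip (B v v) (B w w)"
    using v w by (simp add: diag tangent.ip_scale_left tangent.ip_scale_right tangent_scale)
  have wv: "conn w v = (- 1 / 2) \<star> ?b - B v w"
    using v w by (intro ext) (simp add: conn_eq br_antisym[of v w] B_sym[of w v] tscale_apply)
  have vw: "conn v w = (1 / 2) \<star> ?b - B v w" using v w by (simp add: conn_eq)
  have c2: "ip (conn w v) (conn v w) = ip (B v w) (B v w) - 1 / 4 * ip ?b ?b"
    unfolding wv vw using v w b tangent.ip_sym[of ?b 0 "B v w"]
    by (simp add: tangent.ip_diff_left tangent.ip_diff_right tangent.ip_scale_left
        tangent.ip_scale_right tangent_scale tangent.diff algebra_simps)
  have "ip (conn (br w v) v) w = - ip (conn ?b v) w"
    using v w b by (simp add: br_antisym[of v w] conn_scale_left tangent.ip_scale_left)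
  moreover have "2 * ip (conn ?b v) w = ip (br ?b v) w - ip ?b ?b + ip (br w ?b) v"
    using koszul_identity[OF b v w] by simp
  moreover have "ip (br ?b v) w = - ip (br v ?b) w" "ip (br w ?b) v = - ip (br ?b w) v"
    using v w b by (simp_all add: br_antisym[of v ?b] br_antisym[of ?b w] tangent.ip_scale_left)
  ultimately have c3: "ip (conn (br w v) v) w =
      1 / 2 * ip (br v ?b) w + 1 / 2 * ip ?b ?b + 1 / 2 * ip (br ?b w) v" by simp
  show ?thesis
    using ip_curvature[OF w v v w] c1 c2 c3 by simp
qed

end

section \<open>The Lorentz force and the magnetic sectional curvature\<close>

locale magnetic_lie_group = lie_group_connection A g nabla
  for A :: "('g::{t2_space, second_countable_topology, group_add}, 'e::euclidean_space) chart set"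
    and g :: "'g tensor2" and nabla :: "'g vfield \<Rightarrow> 'g vfield \<Rightarrow> 'g vfield" +
  fixes \<sigma> :: "'g tensor2"
  assumes two_form: "two_form A \<sigma>" and left_invariant_form: "left_invariant A \<sigma>"
begin

lemma form_add_left: "u \<in> tangent_space A p \<Longrightarrow> v \<in> tangent_space A p \<Longrightarrow> w \<in> tangent_space A p \<Longrightarrow>
    \<sigma> p (u + v) w = \<sigma> p u w + \<sigma> p v w"
  and form_add_right: "u \<in> tangent_space A p \<Longrightarrow> v \<in> tangent_space A p \<Longrightarrow> w \<in> tangent_space A p \<Longrightarrow>
    \<sigma> p u (v + w) = \<sigma> p u v + \<sigma> p u w"
  and form_scale_left: "u \<in> tangent_space A p \<Longrightarrow> v \<in> tangent_space A p \<Longrightarrow> \<sigma> p (c \<star> u) v = c * \<sigma> p u v"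
  and form_scale_right: "u \<in> tangent_space A p \<Longrightarrow> v \<in> tangent_space A p \<Longrightarrow> \<sigma> p u (c \<star> v) = c * \<sigma> p u v"
  and form_alternating: "u \<in> tangent_space A p \<Longrightarrow> \<sigma> p u u = 0"
  and form_smooth: "X \<in> VF \<Longrightarrow> Y \<in> VF \<Longrightarrow> smooth_fun A UNIV (\<lambda>p. \<sigma> p (X p) (Y p))"
  using two_form by (simp_all add: two_form_def smooth_tensor2_def)

lemma form_antisym:
  assumes "u \<in> tangent_space A p" "v \<in> tangent_space A p"
  shows "\<sigma> p v u = - \<sigma> p u v"
proof -
  have "\<sigma> p (u + v) (u + v) = \<sigma> p u u + \<sigma> p u v + (\<sigma> p v u + \<sigma> p v v)"
    using assms by (simp only: form_add_left form_add_right tangent_add)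
  then show ?thesis using assms by (simp add: form_alternating tangent_add)
qed

abbreviation lorentz :: "'g \<Rightarrow> 'g tvec \<Rightarrow> 'g tvec" where "lorentz \<equiv> lorentz_force A g \<sigma>"

lemma lorentz:
  assumes v: "v \<in> tangent_space A p"
  shows lorentz_in: "lorentz p v \<in> tangent_space A p"
    and ip_lorentz: "w \<in> tangent_space A p \<Longrightarrow> g p (lorentz p v) w = \<sigma> p v w"
proof -
  have "\<exists>!u. u \<in> tangent_space A p \<and> (\<forall>w\<in>tangent_space A p. \<sigma> p v w = g p u w)"
    by (rule riesz) (use v in \<open>simp_all add: form_add_right form_scale_right\<close>)
  from theI'[OF this] have "lorentz p v \<in> tangent_space A p \<and>
      (\<forall>w\<in>tangent_space A p. \<sigma> p v w = g p (lorentz p v) w)"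
    unfolding lorentz_force_def .
  then show "lorentz p v \<in> tangent_space A p"
    "w \<in> tangent_space A p \<Longrightarrow> g p (lorentz p v) w = \<sigma> p v w" by auto
qed

lemma lorentz_skew:
  assumes "v \<in> tangent_space A p" "w \<in> tangent_space A p"
  shows "g p (lorentz p v) w = - g p v (lorentz p w)"
  using assms form_antisym[of w p v] tangent.ip_sym[of v p "lorentz p w"]
  by (simp add: ip_lorentz lorentz_in)

lemma lorentz_add:
  assumes "u \<in> tangent_space A p" "v \<in> tangent_space A p"
  shows "lorentz p (u + v) = lorentz p u + lorentz p v"
  by (rule tangent.ip_eqI[where p = p]) (use assms in \<open>simp_all add: lorentz_in tangent_add ip_lorentz
      tangent.ip_add_left form_add_left\<close>)

lemma lorentz_scale:
  assumes "u \<in> tangent_space A p"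
  shows "lorentz p (c \<star> u) = c \<star> lorentz p u"
  by (rule tangent.ip_eqI[where p = p]) (use assms in \<open>simp_all add: lorentz_in tangent_scale ip_lorentz
      tangent.ip_scale_left form_scale_left\<close>)

definition lorentz_field :: "'g vfield \<Rightarrow> 'g vfield" where
  "lorentz_field X = (\<lambda>q. lorentz q (X q))"

text \<open>The coefficients of the image in the orthonormal frame are values of \<open>\<sigma>\<close> on smooth fields.\<close>

lemma lorentz_field_VF:
  assumes X: "X \<in> VF"
  shows "lorentz_field X \<in> VF"
proof -
  obtain E where E: "frame E" using frame_exists by blast
  let ?F = "\<lambda>e. fscale (\<lambda>q. \<sigma> q (X q) (left_inv e q)) (left_inv e)"
  have EV: "left_inv e \<in> VF" if "e \<in> E" for e
    using E that by (auto simp: frame_def intro: left_inv_vector_field)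
  have "lorentz_field X = (\<Sum>e\<in>E. ?F e)"
  proof
    fix q
    have Xq: "X q \<in> tangent_space A q" using X by (rule vector_field_tangent)
    have "lorentz q (X q) = (\<Sum>e\<in>E. g q (lorentz q (X q)) (left_inv e q) \<star> left_inv e q)"
      using E lorentz_in[OF Xq] by (simp add: frame_def)
    also have "\<dots> = (\<Sum>e\<in>E. \<sigma> q (X q) (left_inv e q) \<star> left_inv e q)"
      using Xq EV vector_field_tangent by (intro sum.cong) (simp_all add: ip_lorentz)
    also have "\<dots> = (\<Sum>e\<in>E. ?F e) q"
      by (simp add: sum_tvec_apply fscale_apply)
    finally show "lorentz_field X q = (\<Sum>e\<in>E. ?F e) q"
      unfolding lorentz_field_def .
  qed
  moreover have "(\<Sum>e\<in>E. ?F e) \<in> VF"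
    by (rule vector_field_sum) (use E X EV in \<open>auto simp: frame_def intro!: vector_field_fscale form_smooth\<close>)
  ultimately show ?thesis by simp
qed

text \<open>Both fields represent the same left-invariant functional with respect to the left-invariant
  metric.\<close>

lemma lorentz_field_left_inv:
  assumes v: "v \<in> lie_algebra"
  shows "lorentz_field (left_inv v) = left_inv (lorentz 0 v)"
proof
  fix p
  have form: "\<sigma> p (left_inv x p) (left_inv y p) = \<sigma> 0 x y"
    if "x \<in> lie_algebra" "y \<in> lie_algebra" for x y
    using left_invariant_form that unfolding left_invariant_def left_inv_field_def
    by (metis add.right_neutral)
  have Yv: "lorentz 0 v \<in> lie_algebra" using v by (rule lorentz_in)
  show "lorentz_field (left_inv v) p = left_inv (lorentz 0 v) p"
    unfolding lorentz_field_def
  proof (rule tangent.ip_eqI[where p = p])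
    fix w assume "w \<in> tangent_space A p"
    then obtain y where y: "y \<in> lie_algebra" "w = left_inv y p" by (rule translate_to_identity)
    then show "g p (lorentz p (left_inv v p)) w = g p (left_inv (lorentz 0 v) p) w"
      using v Yv by (simp add: ip_lorentz left_inv_tangent form metric_left_inv)
  qed (use v Yv in \<open>simp_all add: lorentz_in left_inv_tangent\<close>)
qed

text \<open>\<open>cov X Z\<close> is \<open>(\<nabla>\<^sub>X Y)(Z)\<close> for the Lorentz force \<open>Y\<close>.\<close>

definition cov :: "'g vfield \<Rightarrow> 'g vfield \<Rightarrow> 'g vfield" where
  "cov X Z = nabla X (lorentz_field Z) - lorentz_field (nabla X Z)"

lemma lorentz_field_add: "X \<in> VF \<Longrightarrow> Y \<in> VF \<Longrightarrow> lorentz_field (X + Y) = lorentz_field X + lorentz_field Y"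
  and lorentz_field_fscale: "X \<in> VF \<Longrightarrow> lorentz_field (fscale h X) = fscale h (lorentz_field X)"
  by (intro ext; simp add: lorentz_field_def fscale_def lorentz_add lorentz_scale vector_field_tangent)+

lemma cov_add_left: "X \<in> VF \<Longrightarrow> Y \<in> VF \<Longrightarrow> Z \<in> VF \<Longrightarrow> cov (X + Y) Z = cov X Z + cov Y Z"
  and cov_add_right: "X \<in> VF \<Longrightarrow> Y \<in> VF \<Longrightarrow> Z \<in> VF \<Longrightarrow> cov X (Y + Z) = cov X Y + cov X Z"
  and cov_fscale_left:
    "X \<in> VF \<Longrightarrow> Z \<in> VF \<Longrightarrow> smooth_fun A UNIV h \<Longrightarrow> cov (fscale h X) Z = fscale h (cov X Z)"
  and cov_fscale_right:
    "X \<in> VF \<Longrightarrow> Z \<in> VF \<Longrightarrow> smooth_fun A UNIV h \<Longrightarrow> cov X (fscale h Z) = fscale h (cov X Z)"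
  by (simp_all add: cov_def nabla_add_left nabla_add_right nabla_fscale_left nabla_fscale_right
      nabla_VF lorentz_field_VF lorentz_field_add lorentz_field_fscale vector_field_fscale
      vector_field_smooth fscale_diff)

lemma cov_pointwise:
  assumes VF: "X \<in> VF" "Z \<in> VF" "X' \<in> VF" "Z' \<in> VF" and eq: "X p = X' p" "Z p = Z' p"
  shows "cov X Z p = cov X' Z' p"
proof -
  have "cov X Z p = cov X' Z p"
    by (rule tensorial_pointwise[where p = p and S = "\<lambda>X. cov X Z p"])
      (use VF eq in \<open>simp_all add: cov_add_left cov_fscale_left fscale_apply\<close>)
  also have "\<dots> = cov X' Z' p"
    by (rule tensorial_pointwise[where p = p and S = "\<lambda>Z. cov X' Z p"])
      (use VF eq in \<open>simp_all add: cov_add_right cov_fscale_right fscale_apply\<close>)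
  finally show ?thesis .
qed

lemma cov_deriv_at_identity:
  assumes u: "u \<in> lie_algebra" and v: "v \<in> lie_algebra"
  shows "cov_deriv_at A nabla lorentz 0 u v = conn u (lorentz 0 v) - lorentz 0 (conn u v)"
proof -
  have "cov_deriv_at A nabla lorentz 0 u v = cov (extend A 0 u) (extend A 0 v) 0"
    by (simp add: cov_deriv_at_def Let_def cov_def lorentz_field_def)
  also have "\<dots> = cov (left_inv u) (left_inv v) 0"
    using u v by (intro cov_pointwise)
      (simp_all add: extend_at_identity left_inv_vector_field left_inv_at_identity)
  also have "\<dots> = conn u (lorentz 0 v) - lorentz 0 (conn u v)"
    using v by (simp add: cov_def lorentz_field_left_inv conn_def)
      (simp add: lorentz_field_def)
  finally show ?thesis .
qed

text \<open>Metric compatibility, as inner products of left-invariant fields are constant.\<close>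

lemma conn_skew:
  assumes "x \<in> lie_algebra" "y \<in> lie_algebra" "z \<in> lie_algebra"
  shows "ip (conn x y) z = - ip (conn x z) y"
  using koszul_identity[OF assms(1,2,3)] koszul_identity[OF assms(1,3,2)] assms
  by (simp add: br_antisym[of x y] br_antisym[of x z] br_antisym[of y z] tangent.ip_scale_left)

lemma ip_cov_deriv:
  assumes "u \<in> lie_algebra" "v \<in> lie_algebra" "w \<in> lie_algebra"
  shows "ip (cov_deriv_at A nabla lorentz 0 u v) w = ip (conn u (lorentz 0 v)) w + ip (conn u v) (lorentz 0 w)"
  using assms by (simp add: cov_deriv_at_identity tangent.ip_diff_left lorentz_in lorentz_skew)

text \<open>Orthogonality of \<open>v\<close> and \<open>w\<close> removes the projections onto the complement of \<open>v\<close> from inner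
  products with \<open>w\<close>.\<close>

lemma magnetic_sectional_curvature:
  assumes v: "v \<in> lie_algebra" and w: "w \<in> lie_algebra" and orth: "ip v w = 0"
  shows "magnetic_sec A g \<sigma> nabla s 0 v w =
    s\<^sup>2 * (- 3 / 4 * ip (br v w) (br v w) - 1 / 2 * ip (br (br v w) w) v
          - 1 / 2 * ip (br v (br v w)) w - ip (B v v) (B w w) + ip (B v w) (B v w))
    - s * (ip (br w (lorentz 0 v)) w + 1 / 2 * ip (br w v) (lorentz 0 w)
          - 1 / 2 * ip (br v (lorentz 0 w)) w - 1 / 2 * ip (br w (lorentz 0 w)) v)
    + 3 / 4 * (ip w (lorentz 0 v))\<^sup>2 + 1 / 4 * ip (lorentz 0 w) (lorentz 0 w)"
proof -
  let ?Y = "lorentz 0"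
  let ?R = "curvature_at A nabla 0 w v v"
  let ?C = "\<lambda>u x. cov_deriv_at A nabla lorentz 0 u x"
  have Y: "?Y v \<in> lie_algebra" "?Y w \<in> lie_algebra" "?Y (?Y w) \<in> lie_algebra"
    using v w by (simp_all add: lorentz_in)
  have R: "?R \<in> lie_algebra"
    using v w by (simp add: curvature_at_identity curv_def tangent.diff vector_field_tangent
        nabla_VF bracket_VF left_inv_vector_field)
  have C: "?C w v \<in> lie_algebra" "?C v w \<in> lie_algebra"
    using v w Y by (simp_all add: cov_deriv_at_identity tangent.diff lorentz_in)
  have perp_in: "proj_perp g 0 v x \<in> lie_algebra" if "x \<in> lie_algebra" for x
    using v that by (simp add: proj_perp_def proj_top_def tangent.diff tangent_scale)
  have perp: "ip (proj_perp g 0 v x) w = ip x w" if "x \<in> lie_algebra" for x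
    using v w that orth by (simp add: proj_perp_def proj_top_def tangent.ip_diff_left
        tangent.ip_scale_left tangent_scale)
  \<comment> \<open>\<open>\<nabla>\<^sub>v Y\<close> is skew, hence its quadratic form vanishes.\<close>
  have "ip (?C v w) w = 0"
    using v w Y conn_skew[of v w "?Y w"] by (simp add: ip_cov_deriv)
  then have magR: "ip (magnetic_R A g \<sigma> nabla s 0 v w) w = s\<^sup>2 * ip ?R w - s * ip (?C w v) w"
    using v w R C perp_in perp
    by (simp add: magnetic_R_def Let_def tangent.ip_diff_left tangent.ip_add_left tangent.ip_scale_left
        tangent_scale tangent.diff)
  have magR_in: "magnetic_R A g \<sigma> nabla s 0 v w \<in> lie_algebra"
    using R C perp_in by (simp add: magnetic_R_def Let_def tangent_add tangent_scale tangent.diff)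
  have top: "?Y (proj_top g 0 v (?Y w)) = ip (?Y w) v \<star> ?Y v"
    using v by (simp add: proj_top_def lorentz_scale)
  have magA_in: "magnetic_A A g \<sigma> 0 v w \<in> lie_algebra"
    using Y perp_in by (simp add: magnetic_A_def Let_def top tangent_scale tangent.diff)
  have magA: "ip (magnetic_A A g \<sigma> 0 v w) w = 3 / 4 * (ip w (?Y v))\<^sup>2 + 1 / 4 * ip (?Y w) (?Y w)"
  proof -
    have "ip (magnetic_A A g \<sigma> 0 v w) w = - 3 / 4 * (ip (?Y w) v * ip (?Y v) w) - 1 / 4 * ip (?Y (?Y w)) w"
      using v w Y perp_in perp
      by (simp add: magnetic_A_def Let_def top tangent.ip_diff_left tangent.ip_scale_left tangent_scale)
    moreover have "ip (?Y w) v = - ip w (?Y v)" using v w by (simp add: lorentz_skew)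
    moreover have "ip (?Y v) w = ip w (?Y v)" using w Y by (simp add: tangent.ip_sym[of w])
    moreover have "ip (?Y (?Y w)) w = - ip (?Y w) (?Y w)" using w Y by (simp add: lorentz_skew)
    ultimately show ?thesis by (simp add: power2_eq_square)
  qed
  have C1: "ip (?C w v) w = ip (br w (?Y v)) w + 1 / 2 * ip (br w v) (?Y w)
      - 1 / 2 * ip (br v (?Y w)) w - 1 / 2 * ip (br w (?Y w)) v"
  proof -
    have "br w w = 0" using w by (simp add: br_eq_conn)
    then have "ip (conn w (?Y v)) w = ip (br w (?Y v)) w"
      using koszul_identity[of w "?Y v" w] v w Y
      by (simp add: br_antisym[of w "?Y v"] tangent.ip_scale_left tangent.ip_zero_left)
    moreover have "2 * ip (conn w v) (?Y w) = ip (br w v) (?Y w) - ip (br v (?Y w)) w - ip (br w (?Y w)) v"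
      using koszul_identity[of w v "?Y w"] v w Y
      by (simp add: br_antisym[of w "?Y w"] tangent.ip_scale_left)
    ultimately show ?thesis using v w by (simp add: ip_cov_deriv)
  qed
  have "magnetic_sec A g \<sigma> nabla s 0 v w =
      ip (magnetic_R A g \<sigma> nabla s 0 v w) w + ip (magnetic_A A g \<sigma> 0 v w) w"
    using magR_in magA_in w by (simp add: magnetic_sec_def tangent.ip_add_left)
  then show ?thesis
    unfolding magR magA C1 ip_sectional_curvature[OF v w] by simp
qed

end

theorem proposition4p2:
  fixes A :: "('g::{t2_space, second_countable_topology, group_add}, 'e::euclidean_space) chart set"
    and g \<sigma> :: "'g tensor2"
    and nabla :: "'g vfield \<Rightarrow> 'g vfield \<Rightarrow> 'g vfield"
    and s :: real and v w :: "'g tvec"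
  assumes "lie_group A" and "connected (UNIV :: 'g set)"
    and "magnetic_system A g \<sigma>" and "left_invariant A g" and "left_invariant A \<sigma>"
    and "levi_civita A g nabla"
    and "s > 0"
    and "v \<in> tangent_space A 0" and "w \<in> tangent_space A 0"
    and "g 0 v v = 1" and "g 0 w w = 1" and "g 0 v w = 0"
  shows
    "(let ip = g 0;
          nrm = (\<lambda>x. sqrt (ip x x));
          br = lie_bracket A;
          Y = lorentz_force A g \<sigma> 0;
          B = (\<lambda>x y. (1 / 2) \<star> (ad_adjoint A g x y + ad_adjoint A g y x))
      in magnetic_sec A g \<sigma> nabla s 0 v w =
           s\<^sup>2 * (- 3 / 4 * (nrm (br v w))\<^sup>2 - 1 / 2 * ip (br (br v w) w) v
                  - 1 / 2 * ip (br v (br v w)) w - ip (B v v) (B w w) + (nrm (B v w))\<^sup>2)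
           - s * (ip (br w (Y v)) w + 1 / 2 * ip (br w v) (Y w)
                  - 1 / 2 * ip (br v (Y w)) w - 1 / 2 * ip (br w (Y w)) v)
           + 3 / 4 * (ip w (Y v))\<^sup>2 + 1 / 4 * (nrm (Y w))\<^sup>2)"
proof -
  interpret magnetic_lie_group A g nabla \<sigma>
    by unfold_locales
      (use assms in \<open>simp_all add: lie_group_def magnetic_system_def closed_two_form_def\<close>)
  have norm: "(sqrt (ip x x))\<^sup>2 = ip x x" if "x \<in> lie_algebra" for x
    using tangent.ip_pos[of x 0] tangent.ip_zero_left[of 0 0] tangent.zero that
    by (cases "x = 0") (simp_all add: less_imp_le)
  have "br v w \<in> lie_algebra" "B v w \<in> lie_algebra" "lorentz 0 w \<in> lie_algebra"
    using assms(8,9) by (simp_all add: lorentz_in)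
  then show ?thesis
    unfolding Let_def B_def[symmetric]
    by (simp only: norm magnetic_sectional_curvature[OF assms(8,9,12)])
qed

end
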